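(* Let $G:[B(\mathcal H)^n]_1\to B(\mathcal H)$ be a free holomorphic function (with scalar coefficients) with $\Re G>0$. Let $\{z_k\}_{k=1}^\infty\subset\mathbb B_n$ be a sequence such that $\lim_{k\to\infty}z_k=\xi\in\partial\mathbb B_n$, $\lim_{k\to\infty}|G(z_k)|=\infty$, and such that $$\lim_{k\to\infty}\frac{\Re G(z_k)}{(1-\|z_k\|_2^2)|G(z_k)|^2}=M<\infty.$$ Then $M>0$ and $$\Re G(X)\ge\frac{1}{4M}(I-X\xi^* )^{-1}(I-XX^* )(I-\xi X^* )^{-1}$$ for any $X\in[B(\mathcal H)^n]_1$.
   Context: $\mathcal H$ is a separable infinite dimensional Hilbert space. A tuple $X=(X_1,\dots,X_n)\in B(\mathcal H)^n$ is identified with the row operator $[X_1\,\cdots\,X_n]$; $XX^*=\sum_iX_iX_i^*$, $\|X\|=\|XX^*\|^{1/2}$, $[B(\mathcal H)^n]_1=\{X:\|X\|<1\}$. $\mathbb B_n$ is the open Euclidean unit ball of $\mathbb C^n$ and $\partial\mathbb B_n$ its boundary sphere; for $\xi\in\mathbb C^n$, $X\xi^*=\sum_i\bar\xi_iX_i$ and $\xi X^*=\sum_i\xi_iX_i^*$. $\mathbb F_n^+$ is the unital free semigroup on $g_1,\dots,g_n$; for $\alpha=g_{i_1}\cdots g_{i_k}$ put $|\alpha|=k$, $X_\alpha=X_{i_1}\cdots X_{i_k}$ ($X_\alpha=I$ for the neutral element, of length $0$). A free holomorphic function with scalar coefficients is a map $G(X)=\sum_{k=0}^\infty\sum_{|\alpha|=k}a_\alpha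 X_\alpha$, $a_\alpha\in\mathbb C$, the series in $k$ converging in operator norm for all $X\in[B(\mathcal H)^n]_1$. For $z\in\mathbb B_n$ (identified with $(z_1I,\dots,z_nI)$), $G(z)=\sum_\alpha a_\alpha z_\alpha$ is a complex number. $\Re T=\frac12(T+T^* )$; $\Re G>0$ means that $\Re G(X)$ is positive and invertible for every $X\in[B(\mathcal H)^n]_1$. *)

theory Defs
  imports "HOL-Analysis.Analysis"
begin

section \<open>Complex Hilbert spaces\<close>

text \<open>
  A complex Hilbert space is a complete real inner product space carrying a compatible
  complex structure. The norm is that of the underlying real space, so
  \<open>norm x ^ 2 = Re (cinner x x)\<close>. The inner product is linear in the first argument.
\<close>

class chilbert_space = real_inner + complete_space +
  fixes scaleC :: "complex \<Rightarrow> 'a \<Rightarrow> 'a" (infixr \<open>*\<^sub>C\<close> 75)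
    and cinner :: "'a \<Rightarrow> 'a \<Rightarrow> complex"
  assumes scaleC_add_right: "c *\<^sub>C (x + y) = c *\<^sub>C x + c *\<^sub>C y"
    and scaleC_add_left: "(c + d) *\<^sub>C x = c *\<^sub>C x + d *\<^sub>C x"
    and scaleC_scaleC: "c *\<^sub>C (d *\<^sub>C x) = (c * d) *\<^sub>C x"
    and scaleC_of_real: "complex_of_real r *\<^sub>C x = r *\<^sub>R x"
    and cinner_add_left: "cinner (x + y) w = cinner x w + cinner y w"
    and cinner_scaleC_left: "cinner (c *\<^sub>C x) y = c * cinner x y"
    and cinner_commute: "cinner x y = cnj (cinner y x)"
    and Re_cinner: "Re (cinner x y) = inner x y"

lemma scaleC_one: "1 *\<^sub>C x = (x :: 'a :: chilbert_space)"
  using scaleC_of_real[of 1 x] by simp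

global_interpretation complex_vector:
  vector_space "scaleC :: complex \<Rightarrow> 'a \<Rightarrow> 'a :: chilbert_space"
  by unfold_locales (simp_all add: scaleC_add_right scaleC_add_left scaleC_scaleC scaleC_one)

lemma cinner_self: "cinner x x = complex_of_real ((norm x)\<^sup>2)"
  for x :: "'a :: chilbert_space"
proof (rule complex_eqI)
  show "Re (cinner x x) = Re (complex_of_real ((norm x)\<^sup>2))"
    by (simp add: Re_cinner power2_norm_eq_inner)
  show "Im (cinner x x) = Im (complex_of_real ((norm x)\<^sup>2))"
    using cinner_commute[of x x] by (metis Im_complex_of_real Reals_cnj_iff complex_is_Real_iff)
qed

lemma norm_scaleC: "norm (c *\<^sub>C x) = cmod c * norm x"
  for x :: "'a :: chilbert_space"
proof -
  have "cinner (c *\<^sub>C x) (c *\<^sub>C x) = c * cnj c * cinner x x"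
    by (metis cinner_commute cinner_scaleC_left complex_cnj_mult mult.assoc mult.left_commute)
  then have "complex_of_real ((norm (c *\<^sub>C x))\<^sup>2) = complex_of_real ((cmod c * norm x)\<^sup>2)"
    by (simp add: cinner_self complex_norm_square power_mult_distrib del: of_real_power)
  then have "(norm (c *\<^sub>C x))\<^sup>2 = (cmod c * norm x)\<^sup>2"
    using of_real_eq_iff by blast
  then show ?thesis by simp
qed

definition infinite_dimensional :: "'a::chilbert_space itself \<Rightarrow> bool" where
  "infinite_dimensional _ \<longleftrightarrow> (\<nexists>B :: 'a set. finite B \<and> complex_vector.span B = UNIV)"

section \<open>Bounded operators\<close>

text \<open>
  The type of bounded real-linear maps supplies the operator norm, whose value on a complex
  linear map is the usual one; \<open>BH\<close> singles out the complex linear maps.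
\<close>

type_synonym 'a bop = "'a \<Rightarrow>\<^sub>L 'a"

definition BH :: "('a::chilbert_space) bop set" where
  "BH = {T. \<forall>c x. blinfun_apply T (c *\<^sub>C x) = c *\<^sub>C blinfun_apply T x}"

lift_definition scale_op :: "complex \<Rightarrow> ('a::chilbert_space) bop \<Rightarrow> 'a bop"
  is "\<lambda>c T x. c *\<^sub>C T x"
proof -
  fix c and T :: "'a \<Rightarrow> 'a"
  assume "bounded_linear T"
  then interpret T: bounded_linear T .
  obtain K where K: "\<And>x. norm (T x) \<le> norm x * K"
    using T.bounded by blast
  show "bounded_linear (\<lambda>x. c *\<^sub>C T x)"
  proof (rule bounded_linear_intro)
    show "c *\<^sub>C T (x + y) = c *\<^sub>C T x + c *\<^sub>C T y" for x y
      by (simp add: T.add scaleC_add_right)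
    show "c *\<^sub>C T (r *\<^sub>R x) = r *\<^sub>R (c *\<^sub>C T x)" for r x
      by (simp only: T.scaleR scaleC_scaleC mult.commute[of c] flip: scaleC_of_real[of r "T x"] scaleC_of_real[of r "c *\<^sub>C T x"])
    show "norm (c *\<^sub>C T x) \<le> norm x * (cmod c * K)" for x
      using mult_left_mono[OF K, of "cmod c" x] by (simp add: norm_scaleC algebra_simps)
  qed
qed

definition adj :: "('a::chilbert_space) bop \<Rightarrow> 'a bop" where
  "adj T = (THE S. S \<in> BH \<and> (\<forall>x y. cinner (T x) y = cinner x (S y)))"

definition is_inverse_op :: "('a::chilbert_space) bop \<Rightarrow> 'a bop \<Rightarrow> bool" where
  "is_inverse_op T S \<longleftrightarrow> S \<in> BH \<and> T o\<^sub>L S = id_blinfun \<and> S o\<^sub>L T = id_blinfun"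

definition invertible_op :: "('a::chilbert_space) bop \<Rightarrow> bool" where
  "invertible_op T \<longleftrightarrow> (\<exists>S. is_inverse_op T S)"

definition inv_op :: "('a::chilbert_space) bop \<Rightarrow> 'a bop" where
  "inv_op T = (THE S. is_inverse_op T S)"

definition positive_op :: "('a::chilbert_space) bop \<Rightarrow> bool" where
  "positive_op T \<longleftrightarrow> (\<forall>x. cinner (T x) x \<in> \<real>\<^sub>\<ge>\<^sub>0)"

definition op_le :: "('a::chilbert_space) bop \<Rightarrow> 'a bop \<Rightarrow> bool" (infix \<open>\<le>\<^sub>o\<close> 50) where
  "A \<le>\<^sub>o B \<longleftrightarrow> positive_op (B - A)"

definition Re_op :: "('a::chilbert_space) bop \<Rightarrow> 'a bop" where
  "Re_op T = (1/2) *\<^sub>R (T + adj T)"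

section \<open>Row operators and free holomorphic functions\<close>

text \<open>Tuples are indexed by a finite type \<open>'n\<close>, and words in the free semigroup are lists over \<open>'n\<close>.\<close>

definition row_sq :: "('n::finite \<Rightarrow> ('a::chilbert_space) bop) \<Rightarrow> 'a bop" where
  "row_sq X = (\<Sum>i\<in>UNIV. X i o\<^sub>L adj (X i))"

definition row_norm :: "('n::finite \<Rightarrow> ('a::chilbert_space) bop) \<Rightarrow> real" where
  "row_norm X = sqrt (norm (row_sq X))"

definition row_ball :: "('n::finite \<Rightarrow> ('a::chilbert_space) bop) set" where
  "row_ball = {X. (\<forall>i. X i \<in> BH) \<and> row_norm X < 1}"

definition word_op :: "('n \<Rightarrow> ('a::chilbert_space) bop) \<Rightarrow> 'n list \<Rightarrow> 'a bop" where
  "word_op X \<alpha> = foldr (\<lambda>i T. X i o\<^sub>L T) \<alpha> id_blinfun"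

definition row_vec :: "('n::finite \<Rightarrow> ('a::chilbert_space) bop) \<Rightarrow> complex ^ 'n \<Rightarrow> 'a bop" where
  \<comment> \<open>\<open>X \<xi>\<^sup>*\<close>\<close>
  "row_vec X \<xi> = (\<Sum>i\<in>UNIV. scale_op (cnj (\<xi> $ i)) (X i))"

definition vec_row :: "complex ^ 'n \<Rightarrow> ('n::finite \<Rightarrow> ('a::chilbert_space) bop) \<Rightarrow> 'a bop" where
  \<comment> \<open>\<open>\<xi> X\<^sup>*\<close>\<close>
  "vec_row \<xi> X = (\<Sum>i\<in>UNIV. scale_op (\<xi> $ i) (adj (X i)))"

text \<open>
  The series is summed over homogeneous parts: the convergence is that of the series in the
  length of words, not unconditional convergence over all words.
\<close>

definition free_holomorphic_with ::
  "('n list \<Rightarrow> complex) \<Rightarrow> (('n::finite \<Rightarrow> ('a::chilbert_space) bop) \<Rightarrow> 'a bop) \<Rightarrow> bool" where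
  "free_holomorphic_with a G \<longleftrightarrow>
     (\<forall>X\<in>row_ball. (\<lambda>k. \<Sum>\<alpha> | length \<alpha> = k. scale_op (a \<alpha>) (word_op X \<alpha>)) sums G X)"

text \<open>The scalar \<open>G(z)\<close> for \<open>z\<close> in the unit ball of \<open>complex ^ 'n\<close>, where \<open>a\<close> are the coefficients of \<open>G\<close>.\<close>

definition scalar_value :: "('n list \<Rightarrow> complex) \<Rightarrow> complex ^ 'n::finite \<Rightarrow> complex" where
  "scalar_value a z = (\<Sum>k. \<Sum>\<alpha> | length \<alpha> = k. a \<alpha> * prod_list (map (\<lambda>i. z $ i) \<alpha>))"

definition Re_positive_on_ball ::
  "(('n::finite \<Rightarrow> ('a::chilbert_space) bop) \<Rightarrow> 'a bop) \<Rightarrow> bool" where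
  "Re_positive_on_ball G \<longleftrightarrow>
     (\<forall>X\<in>row_ball. positive_op (Re_op (G X)) \<and> invertible_op (Re_op (G X)))"

end

theory Submission
  imports Defs
begin

text \<open>
  Write \<open>\<Delta> = I - X X\<^sup>*\<close> and \<open>R\<^sub>z = (I - X z\<^sup>*)\<^sup>-\<^sup>1\<close>. The theorem is a noncommutative Julia lemma, and
  the proof has the classical shape: compare \<open>G X\<close> with \<open>G z\<close> by a two-point Schwarz--Pick inequality
  and let \<open>z\<close> run to the boundary along the given sequence.

  The inequality (lemma \<open>two_point_pick\<close>) says that for all vectors \<open>h\<close>, \<open>v\<close>, with \<open>w = R\<^sub>z \<Delta> v\<close>,
  the real part of
  \<open>\<langle>G(X) h, h\<rangle> + \<langle>G(X) w, h\<rangle> + G(z) \<langle>h, w\<rangle> + G(z) \<langle>\<Delta> v, v\<rangle> / (1 - \<bar>z\<bar>\<^sup>2)\<close>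
  is nonnegative. Replacing \<open>v\<close> by \<open>v / cnj (G(z\<^sub>k))\<close> and using \<open>\<bar>G(z\<^sub>k)\<bar> \<rightarrow> \<infinity>\<close>, the limit is
  \<open>0 \<le> Re \<langle>G(X) h, h\<rangle> + Re \<langle>h, R\<^sub>\<xi> \<Delta> v\<rangle> + M \<langle>\<Delta> v, v\<rangle>\<close> (lemma \<open>boundary_inequality\<close>). For
  \<open>v = - t R\<^sub>\<xi>\<^sup>* h\<close> the right-hand side is a quadratic polynomial in \<open>t\<close> with coefficients
  \<open>Re \<langle>G(X) h, h\<rangle>\<close>, \<open>- \<beta>\<close> and \<open>M \<beta>\<close>, where \<open>\<beta> = \<langle>R\<^sub>\<xi> \<Delta> R\<^sub>\<xi>\<^sup>* h, h\<rangle>\<close>. It is nonnegative for all real \<open>t\<close>.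
  As \<open>\<beta> > 0\<close> for \<open>h \<noteq> 0\<close>, this forces \<open>M > 0\<close>, and \<open>t = 1 / (2 M)\<close> gives
  \<open>Re \<langle>G(X) h, h\<rangle> \<ge> \<beta> / (4 M)\<close>, which is the claim.

  The two-point inequality comes from the positivity of a Toeplitz kernel on words (lemmas
  \<open>toeplitz_kernel_scalar\<close> and \<open>toeplitz_kernel\<close>):
  \<open>Re (\<Sum>\<^sub>\<gamma> \<Sum>\<^sub>\<alpha> a\<^sub>\<gamma> \<langle>c\<^sub>\<alpha>, c\<^sub>\<gamma>\<^sub>\<alpha>\<rangle>) \<ge> 0\<close> for all finitely supported families \<open>c\<close> of vectors and every inner
  product. It holds because \<open>Re G \<ge> 0\<close> at truncated creation operators, which exist on every infinite
  dimensional space. The inner product used is \<open>\<langle>\<Delta> x, y\<rangle>\<close> and the family is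
  \<open>c\<^sub>\<alpha> = X\<^sub>\<alpha>\<^sup>* h + cnj (z\<^sub>\<alpha>) v\<close>. Both
  points \<open>X\<close> and \<open>z\<close> enter through one family of vectors of the given space, which takes the place
  of a tuple of operators on a direct sum.
\<close>

section \<open>The complex inner product\<close>

instance chilbert_space \<subseteq> banach ..

lemma cinner_add_right: "cinner x (y + w) = cinner x y + cinner x w"
  for x :: "'a::chilbert_space"
  by (metis cinner_add_left cinner_commute complex_cnj_add)

lemma cinner_scaleC_right: "cinner x (c *\<^sub>C y) = cnj c * cinner x y"
  for x :: "'a::chilbert_space"
  by (metis cinner_commute cinner_scaleC_left complex_cnj_mult)

lemma cinner_scaleR_left: "cinner (r *\<^sub>R x) y = of_real r * cinner x y"
  for x :: "'a::chilbert_space"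
  by (metis cinner_scaleC_left scaleC_of_real)

lemma cinner_scaleR_right: "cinner x (r *\<^sub>R y) = of_real r * cinner x y"
  for x :: "'a::chilbert_space"
  by (metis cinner_scaleC_right scaleC_of_real complex_cnj_complex_of_real)

lemma cinner_zero_left [simp]: "cinner 0 y = 0" for y :: "'a::chilbert_space"
  using cinner_add_left[of 0 0 y] by simp

lemma cinner_zero_right [simp]: "cinner y 0 = 0" for y :: "'a::chilbert_space"
  using cinner_add_right[of y 0 0] by simp

lemma cinner_diff_left: "cinner (x - y) w = cinner x w - cinner y w"
  for x :: "'a::chilbert_space"
  using cinner_add_left[of "x - y" y w] by simp

lemma cinner_diff_right: "cinner w (x - y) = cinner w x - cinner w y"
  for x :: "'a::chilbert_space"
  using cinner_add_right[of w "x - y" y] by simp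

lemma cinner_sum_left: "cinner (\<Sum>i\<in>I. f i) w = (\<Sum>i\<in>I. cinner (f i) w)"
  for w :: "'a::chilbert_space"
  by (induction I rule: infinite_finite_induct) (auto simp: cinner_add_left)

lemma cinner_sum_right: "cinner w (\<Sum>i\<in>I. f i) = (\<Sum>i\<in>I. cinner w (f i))"
  for w :: "'a::chilbert_space"
  by (induction I rule: infinite_finite_induct) (auto simp: cinner_add_right)

lemma cmod_cinner_le: "cmod (cinner x y) \<le> norm x * norm y" for x :: "'a::chilbert_space"
proof (cases "cinner x y = 0")
  case False
  define c where "c = cnj (cinner x y) / cmod (cinner x y)"
  have c: "cmod c = 1" and cx: "c * cinner x y = of_real (cmod (cinner x y))"
    using False by (auto simp: c_def norm_divide complex_norm_square[symmetric] power2_eq_square mult.commute)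
  have "cmod (cinner x y) = Re (cinner (c *\<^sub>C x) y)"
    by (simp add: cinner_scaleC_left cx)
  also have "\<dots> \<le> norm (c *\<^sub>C x) * norm y"
    unfolding Re_cinner by (rule norm_cauchy_schwarz)
  finally show ?thesis by (simp add: norm_scaleC c)
qed auto

lemma cinner_eq_inner: "cinner x y = Complex (inner x y) (inner x (\<i> *\<^sub>C y))"
  for x :: "'a::chilbert_space"
  by (rule complex_eqI) (simp_all add: cinner_scaleC_right flip: Re_cinner)

lemma cinner_ext: "x = y" if "\<And>w. cinner w x = cinner w y" for x :: "'a::chilbert_space"
proof -
  have "cinner (x - y) (x - y) = 0" using that by (simp add: cinner_diff_right)
  then show ?thesis by (simp add: cinner_self)
qed

lemma cinner_ext_left: "x = y" if "\<And>w. cinner x w = cinner y w" for x :: "'a::chilbert_space"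
  by (rule cinner_ext) (metis cinner_commute that)

lemma bounded_linear_cinner_left: "bounded_linear (\<lambda>x. cinner x (y::'a::chilbert_space))"
  by (rule bounded_linear_intro[where K="norm y"])
    (auto simp: cinner_add_left cinner_scaleR_left scaleR_conv_of_real cmod_cinner_le)

lemmas tendsto_cinner_left = bounded_linear.tendsto[OF bounded_linear_cinner_left]

section \<open>Adjoints\<close>

text \<open>
  The representing vector minimises \<open>\<bar>x\<bar>\<^sup>2 - 2 f x\<close>: the parallelogram law makes every minimising
  sequence Cauchy, and the first-order condition at the minimum is \<open>f y = inner x y\<close>.
\<close>

lemma riesz_representation:
  fixes f :: "'a::chilbert_space \<Rightarrow> real"
  assumes "bounded_linear f"
  shows "\<exists>x. \<forall>y. f y = inner x y"
proof -
  interpret f: bounded_linear f by fact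
  obtain K where K: "\<And>x. \<bar>f x\<bar> \<le> norm x * K" using f.bounded by auto
  define J where "J x = inner x x - 2 * f x" for x
  define m where "m = (INF x. J x)"
  have Jlow: "J x \<ge> - (K\<^sup>2)" for x
  proof -
    have "2 * f x \<le> 2 * (norm x * K)" using K[of x] by linarith
    also have "\<dots> \<le> inner x x + K\<^sup>2"
      using sum_squares_bound[of "norm x" K] by (simp add: power2_norm_eq_inner)
    finally show ?thesis by (simp add: J_def)
  qed
  then have bdd: "bdd_below (range J)" by (auto simp: bdd_below_def)
  have mle: "m \<le> J x" for x unfolding m_def using bdd by (simp add: cINF_lower)
  have "\<exists>x. J x < m + 1 / (real n + 1)" for n
  proof (rule ccontr)
    assume "\<not> ?thesis"
    then have "m + 1 / (real n + 1) \<le> m" unfolding m_def[of] by (intro cINF_greatest) (auto simp: not_less m_def)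
    then show False by simp
  qed
  then obtain x where x: "\<And>n. J (x n) < m + 1 / (real n + 1)" by metis
  have par: "(norm (u - v))\<^sup>2 \<le> 2 * (J u - m) + 2 * (J v - m)" for u v
    using mle[of "(1/2) *\<^sub>R (u + v)"]
    by (simp add: J_def f.scaleR f.add power2_norm_eq_inner inner_diff_left inner_diff_right
        inner_add_left inner_add_right inner_commute field_simps)
  have "Cauchy x"
  proof (rule metric_CauchyI)
    fix e :: real assume e: "e > 0"
    obtain N where N: "1 / (real N + 1) < e\<^sup>2 / 4"
      using e reals_Archimedean[of "e\<^sup>2/4"] by (auto simp: inverse_eq_divide add.commute)
    have "dist (x p) (x q) < e" if "p \<ge> N" "q \<ge> N" for p q
    proof -
      have le: "1 / (real k + 1) \<le> 1 / (real N + 1)" if "k \<ge> N" for k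
        using that by (intro divide_left_mono) auto
      have "(norm (x p - x q))\<^sup>2 < e\<^sup>2"
        using par[of "x p" "x q"] x[of p] x[of q] le[OF that(1)] le[OF that(2)] N by argo
      then show ?thesis using e by (simp add: dist_norm power_less_imp_less_base)
    qed
    then show "\<exists>N. \<forall>p\<ge>N. \<forall>q\<ge>N. dist (x p) (x q) < e" by blast
  qed
  then obtain l where l: "x \<longlonglongrightarrow> l" using Cauchy_convergent convergentD by blast
  have "(\<lambda>n. J (x n)) \<longlonglongrightarrow> J l"
    unfolding J_def by (intro tendsto_intros f.tendsto l)
  moreover have "(\<lambda>n. m + 1 / (real n + 1)) \<longlonglongrightarrow> m + 0"
    by (intro tendsto_add tendsto_const)
      (use LIMSEQ_inverse_real_of_nat in \<open>simp add: inverse_eq_divide add.commute\<close>)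
  ultimately have "J l \<le> m + 0"
    by (rule LIMSEQ_le) (use x less_imp_le in blast)
  then have Jl: "J l \<le> J y" for y using mle[of y] by simp
  have "f y = inner l y" for y
  proof (rule ccontr)
    assume ne: "f y \<noteq> inner l y"
    then have y: "inner y y > 0" by (auto simp: f.zero)
    have quad: "0 \<le> 2 * t * (inner l y - f y) + t * t * inner y y" for t
      using Jl[of "l + t *\<^sub>R y"]
      by (simp add: J_def f.add f.scaleR inner_add_left inner_add_right inner_commute algebra_simps)
    have "0 \<le> - ((inner l y - f y)\<^sup>2 / inner y y)"
    proof -
      have "2 * (- d / q) * d + (- d / q) * (- d / q) * q = - (d\<^sup>2 / q)" if "q > 0" for d q :: real
        using that by (simp add: field_simps power2_eq_square)
      from this[OF y] show ?thesis using quad[of "- (inner l y - f y) / inner y y"] by metis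
    qed
    then show False using ne y by (simp add: divide_le_0_iff not_less[symmetric])
  qed
  then show ?thesis by blast
qed

lemma BH_D: "T \<in> BH \<Longrightarrow> blinfun_apply T (c *\<^sub>C x) = c *\<^sub>C blinfun_apply T x"
  by (simp add: BH_def)

text \<open>The complex adjoint is the real one: testing with \<open>\<i> y\<close> recovers the imaginary part.\<close>

lemma adjoint_exists:
  fixes T :: "'a::chilbert_space bop"
  assumes T: "T \<in> BH"
  shows "\<exists>S. S \<in> BH \<and> (\<forall>x y. cinner (T x) y = cinner x (S y))"
proof -
  have "\<exists>s. \<forall>x. inner (T x) y = inner s x" for y
    by (rule riesz_representation) (intro bounded_linear_intros)
  then obtain s where s: "\<And>x y. inner (T x) y = inner (s y) x" by metis
  have s': "inner (T x) y = inner x (s y)" for x y using s inner_commute by metis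
  have si: "s (\<i> *\<^sub>C y) = \<i> *\<^sub>C s y" for y
  proof -
    have "inner x (s (\<i> *\<^sub>C y)) = inner x (\<i> *\<^sub>C s y)" for x
    proof -
      have move: "inner u (\<i> *\<^sub>C v) = inner ((- \<i>) *\<^sub>C u) v" for u v :: 'a
        unfolding Re_cinner[symmetric] cinner_scaleC_right cinner_scaleC_left by simp
      have "inner x (s (\<i> *\<^sub>C y)) = inner ((- \<i>) *\<^sub>C T x) y"
        by (simp add: move flip: s')
      also have "\<dots> = inner (T ((- \<i>) *\<^sub>C x)) y" by (simp only: BH_D[OF T])
      also have "\<dots> = inner x (\<i> *\<^sub>C s y)" by (simp only: s' move)
      finally show ?thesis .
    qed
    then show ?thesis using inner_commute vector_eq_ldot by metis
  qed
  have c: "cinner (T x) y = cinner x (s y)" for x y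
    by (simp add: cinner_eq_inner s' flip: si)
  have add: "s (x + y) = s x + s y" for x y
    by (rule cinner_ext) (simp add: cinner_add_right flip: c)
  have sc: "s (k *\<^sub>C x) = k *\<^sub>C s x" for k x
    by (rule cinner_ext) (simp add: cinner_scaleC_right flip: c)
  have bl: "bounded_linear s"
  proof (rule bounded_linear_intro)
    show "s (r *\<^sub>R x) = r *\<^sub>R s x" for r x
      using sc[of "of_real r" x] by (simp add: scaleC_of_real)
    show "norm (s x) \<le> norm x * norm T" for x
    proof (cases "s x = 0")
      case False
      have "norm (s x) * norm (s x) = inner (T (s x)) x"
        by (simp add: s' norm_eq_sqrt_inner)
      also have "\<dots> \<le> norm (T (s x)) * norm x" by (rule norm_cauchy_schwarz)
      also have "\<dots> \<le> norm T * norm (s x) * norm x"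
        by (intro mult_right_mono norm_blinfun) auto
      finally show ?thesis using False by (simp add: mult.commute mult.left_commute)
    qed auto
  qed (rule add)
  show ?thesis
    by (rule exI[of _ "Blinfun s"]) (auto simp: BH_def bounded_linear_Blinfun_apply[OF bl] sc c)
qed

lemma adj_eqI:
  fixes T :: "'a::chilbert_space bop"
  assumes "S \<in> BH" "\<And>x y. cinner (T x) y = cinner x (S y)"
  shows "adj T = S"
  unfolding adj_def
proof (rule the_equality)
  fix S' assume "S' \<in> BH \<and> (\<forall>x y. cinner (T x) y = cinner x (S' y))"
  then have "S' y = S y" for y by (intro cinner_ext) (metis assms(2))
  then show "S' = S" by (rule blinfun_eqI)
qed (use assms in blast)

lemma
  fixes T :: "'a::chilbert_space bop"
  assumes "T \<in> BH"
  shows adj_in_BH: "adj T \<in> BH"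
    and cinner_adj: "cinner (T x) y = cinner x (adj T y)"
    and cinner_adj': "cinner (adj T y) x = cinner y (T x)"
proof -
  obtain S where S: "S \<in> BH" "\<And>x y. cinner (T x) y = cinner x (S y)"
    using adjoint_exists[OF assms] by blast
  have "adj T = S" using S by (rule adj_eqI)
  with S show "adj T \<in> BH" "cinner (T x) y = cinner x (adj T y)" by auto
  then show "cinner (adj T y) x = cinner y (T x)" by (metis cinner_commute)
qed

lemma scale_op_apply [simp]: "blinfun_apply (scale_op c T) x = c *\<^sub>C T x"
  by transfer simp

lemma scaleC_scaleR_commute: "c *\<^sub>C (r *\<^sub>R x) = r *\<^sub>R (c *\<^sub>C x)" for x :: "'a::chilbert_space"
  by (metis complex_vector.scale_left_commute scaleC_of_real)

lemma
  shows id_in_BH [simp]: "id_blinfun \<in> BH"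
    and zero_in_BH [simp]: "0 \<in> BH"
    and compose_in_BH: "S \<in> BH \<Longrightarrow> T \<in> BH \<Longrightarrow> S o\<^sub>L T \<in> BH"
    and scale_in_BH: "T \<in> BH \<Longrightarrow> scale_op c T \<in> BH"
    and scaleR_in_BH: "T \<in> BH \<Longrightarrow> r *\<^sub>R T \<in> BH"
    and add_in_BH: "S \<in> BH \<Longrightarrow> T \<in> BH \<Longrightarrow> S + T \<in> BH"
    and diff_in_BH: "S \<in> BH \<Longrightarrow> T \<in> BH \<Longrightarrow> S - T \<in> BH"
  by (auto simp: BH_def blinfun.add_left blinfun.diff_left scaleC_add_right mult.commute scaleC_scaleC
      complex_vector.scale_right_diff_distrib blinfun.scaleR_left scaleC_scaleR_commute)

lemma sum_in_BH: "(\<And>i. i \<in> I \<Longrightarrow> f i \<in> BH) \<Longrightarrow> (\<Sum>i\<in>I. f i) \<in> BH"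
  by (induction I rule: infinite_finite_induct) (auto intro: add_in_BH)

lemma adj_compose: "adj (S o\<^sub>L T) = adj T o\<^sub>L adj S" if "S \<in> BH" "T \<in> BH"
  for S T :: "'a::chilbert_space bop"
  using that by (intro adj_eqI compose_in_BH adj_in_BH) (simp_all add: cinner_adj)

lemma adj_id: "adj id_blinfun = (id_blinfun :: 'a::chilbert_space bop)"
  by (intro adj_eqI) auto

lemma BH_closed:
  assumes "\<And>n. f n \<in> BH" "f \<longlonglongrightarrow> (L :: 'a::chilbert_space bop)"
  shows "L \<in> BH"
  unfolding BH_def
proof safe
  fix c and x :: 'a
  have lim: "(\<lambda>n. f n y) \<longlonglongrightarrow> L y" for y
    by (intro tendsto_intros assms)
  show "L (c *\<^sub>C x) = c *\<^sub>C L x"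
  proof (rule cinner_ext_left)
    fix w
    have "(\<lambda>n. cinner (f n (c *\<^sub>C x)) w) \<longlonglongrightarrow> cinner (L (c *\<^sub>C x)) w"
      by (intro tendsto_cinner_left lim)
    moreover have "(\<lambda>n. c * cinner (f n x) w) \<longlonglongrightarrow> c * cinner (L x) w"
      by (intro tendsto_intros tendsto_cinner_left lim)
    ultimately show "cinner (L (c *\<^sub>C x)) w = cinner (c *\<^sub>C L x) w"
      using LIMSEQ_unique by (auto simp: BH_D[OF assms(1)] cinner_scaleC_left)
  qed
qed

lemma Re_cinner_Re_op: "Re (cinner (Re_op T h) h) = Re (cinner (T h) h)" if "T \<in> BH"
  for T :: "'a::chilbert_space bop"
proof -
  have "Re (cinner (adj T h) h) = Re (cinner (T h) h)"
    by (metis cinner_adj'[OF that] cinner_commute cnj.simps(1))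
  then show ?thesis
    by (simp add: Re_op_def blinfun.scaleR_left blinfun.add_left cinner_scaleR_left cinner_add_left)
qed

section \<open>Orthonormal families\<close>

locale positive_form =
  fixes B :: "'a::chilbert_space \<Rightarrow> 'a \<Rightarrow> complex"
  assumes add_left: "B (x + y) w = B x w + B y w"
    and scaleC_left: "B (c *\<^sub>C x) w = c * B x w"
    and hermitian: "B x y = cnj (B y x)"
    and positive: "x \<noteq> 0 \<Longrightarrow> Re (B x x) > 0"
begin

lemma add_right: "B x (y + w) = B x y + B x w"
  by (metis add_left complex_cnj_add hermitian)

lemma scaleC_right: "B x (c *\<^sub>C y) = cnj c * B x y"
  by (metis scaleC_left complex_cnj_mult hermitian)

lemma zero_left [simp]: "B 0 y = 0"
  using add_left[of 0 0 y] by simp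

lemma zero_right [simp]: "B y 0 = 0"
  using add_right[of y 0 0] by simp

lemma diff_left: "B (x - y) w = B x w - B y w"
  using add_left[of "x - y" y w] by simp

lemma sum_left: "B (\<Sum>i\<in>I. f i) w = (\<Sum>i\<in>I. B (f i) w)"
  by (induction I rule: infinite_finite_induct) (auto simp: add_left)

lemma sum_right: "B w (\<Sum>i\<in>I. f i) = (\<Sum>i\<in>I. B w (f i))"
  by (induction I rule: infinite_finite_induct) (auto simp: add_right)

lemma self_eq: "B x x = of_real (Re (B x x))"
  using hermitian[of x x] by (metis Reals_cnj_iff of_real_Re)

definition orthonormal :: "'a set \<Rightarrow> bool" where
  "orthonormal E \<longleftrightarrow> (\<forall>e\<in>E. \<forall>f\<in>E. B e f = (if e = f then 1 else 0))"

definition expand :: "'a set \<Rightarrow> 'a \<Rightarrow> 'a" where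
  "expand E x = (\<Sum>e\<in>E. B x e *\<^sub>C e)"

lemma expand_residual_orthogonal:
  assumes "finite E" "orthonormal E" "e \<in> E"
  shows "B (x - expand E x) e = 0"
proof -
  have "B (expand E x) e = (\<Sum>f\<in>E. if f = e then B x f else 0)"
    unfolding expand_def sum_left using assms(2,3)
    by (intro sum.cong) (auto simp: scaleC_left orthonormal_def)
  then show ?thesis using assms by (simp add: diff_left)
qed

text \<open>One Gram--Schmidt step: normalise the residual of \<open>x\<close>.\<close>

lemma orthonormal_extend:
  assumes "finite E" "orthonormal E" "x \<noteq> expand E x"
  obtains f where "f \<notin> E" "orthonormal (insert f E)" "x = expand (insert f E) x"
proof -
  define y where "y = x - expand E x"
  define s where "s = sqrt (Re (B y y))"
  define f where "f = of_real (1 / s) *\<^sub>C y"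
  have y0: "y \<noteq> 0" using assms(3) by (simp add: y_def)
  then have s: "s > 0" "s * s = Re (B y y)"
    using positive[of y] by (auto simp: s_def)
  have ye: "B y e = 0" if "e \<in> E" for e
    unfolding y_def by (rule expand_residual_orthogonal[OF assms(1,2) that])
  have fe: "B f e = 0" "B e f = 0" if "e \<in> E" for e
    using ye[OF that] hermitian[of e y] by (simp_all add: f_def scaleC_left scaleC_right)
  have yy: "B y y = of_real (s * s)" using self_eq[of y] s by simp
  have ff: "B f f = 1"
    using s(1) by (simp add: f_def scaleC_left scaleC_right yy)
  have fE: "f \<notin> E" using fe ff by force
  have on: "orthonormal (insert f E)"
    using assms(2) fe ff fE by (auto simp: orthonormal_def)
  have "B (expand E x) y = 0"
  proof -
    have "B e y = 0" if "e \<in> E" for e using ye[OF that] hermitian[of e y] by simp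
    then show ?thesis by (simp add: expand_def sum_left scaleC_left)
  qed
  then have "B x y = B y y" by (simp add: y_def diff_left)
  then have "B x f *\<^sub>C f = y"
    using s(1) by (simp add: f_def scaleC_right yy scaleC_scaleC scaleC_one)
  then have "expand (insert f E) x = x"
    using fE assms(1) by (simp add: expand_def y_def)
  with fE on that show ?thesis by metis
qed

text \<open>
  Coefficients against the new members of a larger family vanish, so expansions survive each
  Gram--Schmidt step.
\<close>

lemma expand_mono:
  assumes "finite E'" "orthonormal E'" "E \<subseteq> E'" "x = expand E x"
  shows "x = expand E' x"
proof -
  have "B x e = 0" if "e \<in> E' - E" for e
  proof -
    have "B x e = B (expand E x) e" using assms(4) by simp
    also have "\<dots> = 0"
      unfolding expand_def sum_left scaleC_left
    proof (intro sum.neutral ballI)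
      fix f assume "f \<in> E"
      then have "f \<in> E'" "f \<noteq> e" using assms(3) that by auto
      then show "B x f * B f e = 0" using assms(2) that by (simp add: orthonormal_def)
    qed
    finally show ?thesis .
  qed
  then have "expand E x = expand E' x"
    unfolding expand_def using assms(1,3) by (intro sum.mono_neutral_left) auto
  with assms(4) show ?thesis by simp
qed

lemma gram_schmidt:
  assumes "finite A"
  shows "\<exists>E. finite E \<and> orthonormal E \<and> (\<forall>x\<in>A. x = expand E x)"
  using assms
proof (induction A)
  case empty
  then show ?case by (intro exI[of _ "{}"]) (simp add: orthonormal_def)
next
  case (insert x A)
  then obtain E where E: "finite E" "orthonormal E" "\<forall>x\<in>A. x = expand E x" by blast
  show ?case
  proof (cases "x = expand E x")
    case True
    with E show ?thesis by blast
  next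
    case False
    then obtain f where f: "orthonormal (insert f E)" "x = expand (insert f E) x"
      using orthonormal_extend E(1,2) by metis
    have "y = expand (insert f E) y" if "y \<in> A" for y
      using expand_mono[of "insert f E" E y] E that f(1) by blast
    with f E(1) show ?thesis by (intro exI[of _ "insert f E"]) auto
  qed
qed

lemma parseval:
  assumes "x = expand E x"
  shows "B x y = (\<Sum>e\<in>E. B x e * cnj (B y e))"
proof -
  have "B x y = B (expand E x) y" using assms by simp
  also have "\<dots> = (\<Sum>e\<in>E. B x e * cnj (B y e))"
    unfolding expand_def sum_left scaleC_left
    by (intro sum.cong refl) (simp flip: hermitian)
  finally show ?thesis .
qed

end

interpretation cinner: positive_form "cinner :: 'a::chilbert_space \<Rightarrow> 'a \<Rightarrow> complex"
  by unfold_locales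
    (simp_all add: cinner_add_left cinner_scaleC_left cinner_self flip: cinner_commute)

lemma bessel:
  fixes x :: "'a::chilbert_space"
  assumes "finite E" "cinner.orthonormal E"
  shows "(\<Sum>e\<in>E. (cmod (cinner x e))\<^sup>2) \<le> (norm x)\<^sup>2"
proof -
  define y where "y = x - cinner.expand E x"
  have ye: "cinner y e = 0" if "e \<in> E" for e
    unfolding y_def by (rule cinner.expand_residual_orthogonal[OF assms that])
  have "cinner y (cinner.expand E x) = 0"
    using ye by (simp add: cinner.expand_def cinner_sum_right cinner_scaleC_right)
  then have "cinner y y = cinner y x"
    by (simp add: y_def cinner_diff_right)
  also have "\<dots> = cinner x x - (\<Sum>e\<in>E. cinner x e * cinner e x)"
    by (simp add: y_def cinner_diff_left cinner.expand_def cinner_sum_left cinner_scaleC_left)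
  also have "(\<Sum>e\<in>E. cinner x e * cinner e x) = of_real (\<Sum>e\<in>E. (cmod (cinner x e))\<^sup>2)"
    unfolding of_real_sum complex_norm_square
    by (intro sum.cong refl) (simp flip: cinner_commute)
  finally have "of_real ((norm y)\<^sup>2) = (of_real ((norm x)\<^sup>2 - (\<Sum>e\<in>E. (cmod (cinner x e))\<^sup>2)) :: complex)"
    by (simp add: cinner_self)
  then have "(norm y)\<^sup>2 = (norm x)\<^sup>2 - (\<Sum>e\<in>E. (cmod (cinner x e))\<^sup>2)"
    using of_real_eq_iff by blast
  then show ?thesis by (metis diff_ge_0_iff_ge zero_le_power2)
qed

lemma orthonormal_set_of_card:
  assumes "infinite_dimensional TYPE('a::chilbert_space)"
  shows "\<exists>E :: 'a set. finite E \<and> card E = n \<and> cinner.orthonormal E"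
proof (induction n)
  case 0
  then show ?case by (intro exI[of _ "{}"]) (simp add: cinner.orthonormal_def)
next
  case (Suc n)
  then obtain E :: "'a set" where E: "finite E" "card E = n" "cinner.orthonormal E" by blast
  obtain x where x: "x \<notin> complex_vector.span E"
    using assms E(1) by (auto simp: infinite_dimensional_def)
  have "cinner.expand E x \<in> complex_vector.span E"
    unfolding cinner.expand_def
    by (intro complex_vector.span_sum complex_vector.span_scale complex_vector.span_base)
  then have "x \<noteq> cinner.expand E x" using x by auto
  then obtain f where "f \<notin> E" "cinner.orthonormal (insert f E)"
    using cinner.orthonormal_extend E by metis
  then show ?case using E by (intro exI[of _ "insert f E"]) simp
qed

section \<open>Row operators\<close>

lemma finite_words [simp]:
  "finite {\<alpha> :: 'n::finite list. length \<alpha> = k}" "finite {\<alpha> :: 'n list. length \<alpha> \<le> k}"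
  "finite {\<alpha> :: 'n list. length \<alpha> < k}"
proof -
  show le: "finite {\<alpha> :: 'n list. length \<alpha> \<le> k}" for k
    using finite_lists_length_le[of "UNIV :: 'n set" k] by simp
  show "finite {\<alpha> :: 'n::finite list. length \<alpha> = k}" "finite {\<alpha> :: 'n list. length \<alpha> < k}"
    by (rule finite_subset[OF _ le[of k]]; auto)+
qed

lemma sum_mult_le_of_sum_squares:
  fixes f g :: "'i \<Rightarrow> real"
  assumes "(\<Sum>i\<in>I. (f i)\<^sup>2) \<le> p\<^sup>2" "(\<Sum>i\<in>I. (g i)\<^sup>2) \<le> q\<^sup>2" "p \<ge> 0" "q \<ge> 0"
  shows "(\<Sum>i\<in>I. f i * g i) \<le> p * q"
proof -
  have "(\<Sum>i\<in>I. f i * g i) \<le> (\<Sum>i\<in>I. \<bar>f i\<bar> * \<bar>g i\<bar>)"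
    by (intro sum_mono) (metis abs_ge_self abs_mult)
  also have "\<dots> \<le> L2_set f I * L2_set g I" by (rule L2_set_mult_ineq)
  also have "\<dots> \<le> p * q"
    using assms by (intro mult_mono) (auto simp: L2_set_def real_le_lsqrt sum_nonneg)
  finally show ?thesis .
qed

lemma cinner_row_sq:
  assumes "\<And>i. X i \<in> BH"
  shows "cinner (row_sq X x) y = (\<Sum>i\<in>UNIV. cinner (adj (X i) x) (adj (X i) y))"
  by (simp add: row_sq_def blinfun.sum_left cinner_sum_left cinner_adj[OF assms])

lemma row_norm_nonneg: "row_norm X \<ge> 0"
  by (simp add: row_norm_def)

lemma sum_norm_adj_le:
  assumes "\<And>i. X i \<in> BH"
  shows "(\<Sum>i\<in>UNIV. (norm (adj (X i) x))\<^sup>2) \<le> (row_norm X * norm x)\<^sup>2"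
proof -
  have "complex_of_real (\<Sum>i\<in>UNIV. (norm (adj (X i) x))\<^sup>2) = cinner (row_sq X x) x"
    by (simp add: cinner_row_sq[OF assms] cinner_self)
  then have "(\<Sum>i\<in>UNIV. (norm (adj (X i) x))\<^sup>2) = Re (cinner (row_sq X x) x)"
    by (metis Re_complex_of_real)
  also have "\<dots> \<le> norm (row_sq X x) * norm x"
    using complex_Re_le_cmod cmod_cinner_le order_trans by blast
  also have "\<dots> \<le> norm (row_sq X) * norm x * norm x"
    by (intro mult_right_mono norm_blinfun) auto
  finally show ?thesis
    by (simp add: row_norm_def power_mult_distrib) (simp add: power2_eq_square mult.assoc)
qed

text \<open>
  The row norm is the norm of the column \<open>x \<mapsto> (X\<^sub>i\<^sup>* x)\<^sub>i\<close>: test \<open>X X\<^sup>* x\<close> against itself and apply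
  Cauchy--Schwarz to the components.
\<close>

lemma row_norm_le:
  assumes "\<And>i. X i \<in> BH" "q \<ge> 0"
    and "\<And>x. (\<Sum>i\<in>UNIV. (norm (adj (X i) x))\<^sup>2) \<le> (q * norm x)\<^sup>2"
  shows "row_norm X \<le> q"
proof -
  have "norm (row_sq X) \<le> q\<^sup>2"
  proof (rule norm_blinfun_bound)
    fix x
    let ?y = "row_sq X x"
    have "(norm ?y)\<^sup>2 = cmod (cinner ?y ?y)" by (simp add: cinner_self norm_power)
    also have "\<dots> \<le> (\<Sum>i\<in>UNIV. norm (adj (X i) x) * norm (adj (X i) ?y))"
      unfolding cinner_row_sq[OF assms(1)] by (intro sum_norm_le cmod_cinner_le)
    also have "\<dots> \<le> (q * norm x) * (q * norm ?y)"
      using assms by (intro sum_mult_le_of_sum_squares) auto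
    finally have "norm ?y * norm ?y \<le> (q\<^sup>2 * norm x) * norm ?y"
      by (simp add: power2_eq_square ac_simps)
    then show "norm ?y \<le> q\<^sup>2 * norm x"
      by (cases "norm ?y = 0") auto
  qed auto
  then show ?thesis unfolding row_norm_def using assms(2) by (simp add: real_le_lsqrt)
qed

section \<open>Truncated creation operators\<close>

definition finite_rank :: "'i set \<Rightarrow> ('i \<Rightarrow> 'a) \<Rightarrow> ('i \<Rightarrow> 'a) \<Rightarrow> 'a::chilbert_space bop" where
  "finite_rank I u v = Blinfun (\<lambda>x. \<Sum>i\<in>I. cinner x (v i) *\<^sub>C u i)"

lemma finite_rank_apply: "finite_rank I u v x = (\<Sum>i\<in>I. cinner x (v i) *\<^sub>C u i)"
proof -
  have "bounded_linear (\<lambda>x. cinner x (v i) *\<^sub>C u i)" for i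
  proof (rule bounded_linear_intro[where K="norm (v i) * norm (u i)"])
    show "cinner (x + y) (v i) *\<^sub>C u i = cinner x (v i) *\<^sub>C u i + cinner y (v i) *\<^sub>C u i" for x y
      by (simp add: cinner_add_left scaleC_add_left)
    show "cinner (r *\<^sub>R x) (v i) *\<^sub>C u i = r *\<^sub>R (cinner x (v i) *\<^sub>C u i)" for r x
      by (metis cinner_scaleR_left scaleC_of_real scaleC_scaleC)
    show "norm (cinner x (v i) *\<^sub>C u i) \<le> norm x * (norm (v i) * norm (u i))" for x
      using mult_right_mono[OF cmod_cinner_le[of x "v i"], of "norm (u i)"]
      by (simp add: norm_scaleC mult.assoc)
  qed
  then show ?thesis unfolding finite_rank_def
    by (subst bounded_linear_Blinfun_apply) (auto intro: bounded_linear_sum)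
qed

lemma finite_rank_in_BH: "finite_rank I u v \<in> BH"
  by (simp add: BH_def finite_rank_apply cinner_scaleC_left complex_vector.scale_sum_right scaleC_scaleC)

lemma adj_finite_rank: "adj (finite_rank I u v) = finite_rank I v u"
proof (rule adj_eqI[OF finite_rank_in_BH])
  show "cinner (finite_rank I u v x) y = cinner x (finite_rank I v u y)" for x y
    by (simp add: finite_rank_apply cinner_sum_left cinner_sum_right cinner_scaleC_left
        cinner_scaleC_right mult.commute flip: cinner_commute)
qed

lemma word_op_simps [simp]:
  "word_op X [] = id_blinfun" "word_op X (i # \<alpha>) = X i o\<^sub>L word_op X \<alpha>"
  by (simp_all add: word_op_def)

lemma word_op_append: "word_op X (\<gamma> @ \<alpha>) = word_op X \<gamma> o\<^sub>L word_op X \<alpha>"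
  by (induction \<gamma>) (auto intro!: blinfun_eqI)

lemma word_op_in_BH: "(\<And>i. X i \<in> BH) \<Longrightarrow> word_op X \<alpha> \<in> BH"
  by (induction \<alpha>) (auto intro: compose_in_BH)

definition homogeneous_part ::
  "('n list \<Rightarrow> complex) \<Rightarrow> ('n::finite \<Rightarrow> ('a::chilbert_space) bop) \<Rightarrow> nat \<Rightarrow> 'a bop" where
  "homogeneous_part a X k = (\<Sum>\<alpha> | length \<alpha> = k. scale_op (a \<alpha>) (word_op X \<alpha>))"

lemma homogeneous_part_in_BH: "(\<And>i. X i \<in> BH) \<Longrightarrow> homogeneous_part a X k \<in> BH"
  unfolding homogeneous_part_def by (intro sum_in_BH scale_in_BH word_op_in_BH)

lemma homogeneous_part_sums:
  "free_holomorphic_with a G \<Longrightarrow> X \<in> row_ball \<Longrightarrow> homogeneous_part a X sums G X"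
  by (simp add: free_holomorphic_with_def homogeneous_part_def[abs_def])

lemma free_holomorphic_in_BH:
  assumes "free_holomorphic_with a G" "X \<in> row_ball"
  shows "G X \<in> BH"
proof (rule BH_closed)
  show "(\<lambda>n. \<Sum>k<n. homogeneous_part a X k) \<longlonglongrightarrow> G X"
    using homogeneous_part_sums[OF assms] by (simp add: sums_def)
qed (use assms in \<open>auto simp: row_ball_def intro!: sum_in_BH homogeneous_part_in_BH\<close>)

lemma Re_cinner_nonneg_on_ball:
  assumes "free_holomorphic_with a G" "Re_positive_on_ball G" "X \<in> row_ball"
  shows "Re (cinner (G X h) h) \<ge> 0"
proof -
  have "0 \<le> Re (cinner (Re_op (G X) h) h)"
    using assms(2,3) by (simp add: Re_positive_on_ball_def positive_op_def complex_nonneg_Reals_iff)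
  then show ?thesis by (simp add: Re_cinner_Re_op[OF free_holomorphic_in_BH[OF assms(1,3)]])
qed

text \<open>
  Test \<open>Re G \<ge> 0\<close> on the weighted creation operators \<open>S i: e \<alpha> \<mapsto> r e (i # \<alpha>)\<close>, where \<open>e\<close> is an
  orthonormal family in the given space indexed by the words of length at most \<open>N\<close>, and
  \<open>S i\<close> kills the words of length \<open>N\<close>. The ranges of the \<open>S i\<close> are orthogonal, so the row norm is
  at most \<open>r\<close>; products of more than \<open>N\<close> factors vanish, so \<open>G S\<close> is a polynomial in \<open>r\<close> and
  \<open>r \<rightarrow> 1\<close> is harmless. Infinite dimension provides \<open>e\<close> for every \<open>N\<close>.
\<close>

lemma toeplitz_kernel_scalar:
  fixes G :: "('n::finite \<Rightarrow> ('a::chilbert_space) bop) \<Rightarrow> 'a bop"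
  assumes inf: "infinite_dimensional TYPE('a)"
    and hol: "free_holomorphic_with a G" and pos: "Re_positive_on_ball G"
  shows "0 \<le> Re (\<Sum>j\<le>N. \<Sum>\<gamma> | length \<gamma> = j. \<Sum>\<alpha> | length \<alpha> \<le> N - j.
                  a \<gamma> * (c \<alpha> * cnj (c (\<gamma> @ \<alpha>))))"
proof -
  let ?W = "{\<alpha> :: 'n list. length \<alpha> \<le> N}"
  let ?V = "{\<alpha> :: 'n list. length \<alpha> < N}"
  obtain E :: "'a set" where E: "finite E" "card E = card ?W" "cinner.orthonormal E"
    using orthonormal_set_of_card[OF inf] by blast
  then obtain e where "bij_betw e ?W E"
    using finite_same_card_bij[of ?W E] by auto
  then have einj: "inj_on e ?W" and eim: "e ` ?W = E"
    by (auto simp: bij_betw_def)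
  have ee: "cinner (e \<alpha>) (e \<beta>) = (if \<alpha> = \<beta> then 1 else 0)"
    if "length \<alpha> \<le> N" "length \<beta> \<le> N" for \<alpha> \<beta>
  proof -
    have "e \<alpha> \<in> E" "e \<beta> \<in> E" using that eim by auto
    moreover have "e \<alpha> = e \<beta> \<longleftrightarrow> \<alpha> = \<beta>" using einj that by (auto simp: inj_on_def)
    ultimately show ?thesis using E(3) by (simp add: cinner.orthonormal_def)
  qed
  define h where "h = (\<Sum>\<alpha>\<in>?W. c \<alpha> *\<^sub>C e \<alpha>)"
  define p where "p j = (\<Sum>\<gamma> | length \<gamma> = j. \<Sum>\<alpha> | length \<alpha> \<le> N - j.
                  a \<gamma> * (c \<alpha> * cnj (c (\<gamma> @ \<alpha>))))" for j
  have pos_r: "0 \<le> Re (\<Sum>j\<le>N. of_real (r ^ j) * p j)" if r: "0 < r" "r < 1" for r :: real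
  proof -
    define S where "S i = finite_rank ?V (\<lambda>\<alpha>. e (i # \<alpha>)) (\<lambda>\<alpha>. r *\<^sub>R e \<alpha>)" for i
    have SB: "S i \<in> BH" for i by (simp add: S_def finite_rank_in_BH)
    have S_e: "S i (e \<alpha>) = (if length \<alpha> < N then r *\<^sub>R e (i # \<alpha>) else 0)" if "length \<alpha> \<le> N" for i \<alpha>
    proof -
      have "S i (e \<alpha>) = (\<Sum>\<beta>\<in>?V. if \<beta> = \<alpha> then r *\<^sub>R e (i # \<beta>) else 0)"
        unfolding S_def finite_rank_apply using that
        by (intro sum.cong) (auto simp: cinner_scaleR_right ee scaleC_of_real)
      then show ?thesis by simp
    qed
    have word_e: "word_op S \<gamma> (e \<alpha>) =
        (if length \<gamma> + length \<alpha> \<le> N then (r ^ length \<gamma>) *\<^sub>R e (\<gamma> @ \<alpha>) else 0)"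
      if "length \<alpha> \<le> N" for \<gamma> \<alpha>
      by (induction \<gamma>) (auto simp: that S_e blinfun.scaleR_right mult.commute)
    have S_ball: "S \<in> row_ball"
    proof -
      have "row_norm S \<le> r"
      proof (rule row_norm_le[OF SB])
        fix x
        have "(norm (adj (S i) x))\<^sup>2 = r\<^sup>2 * (\<Sum>\<alpha>\<in>?V. (cmod (cinner x (e (i # \<alpha>))))\<^sup>2)" for i
        proof -
          let ?y = "adj (S i) x"
          have y: "?y = (\<Sum>\<alpha>\<in>?V. (of_real r * cinner x (e (i # \<alpha>))) *\<^sub>C e \<alpha>)"
            unfolding S_def adj_finite_rank finite_rank_apply
            by (intro sum.cong refl) (metis mult.commute scaleC_of_real scaleC_scaleC)
          have ye: "cinner ?y (e \<alpha>) = of_real r * cinner x (e (i # \<alpha>))" if "\<alpha> \<in> ?V" for \<alpha>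
          proof -
            have "cinner ?y (e \<alpha>) = (\<Sum>\<beta>\<in>?V. if \<beta> = \<alpha> then of_real r * cinner x (e (i # \<beta>)) else 0)"
              unfolding y cinner_sum_left using that
              by (intro sum.cong) (auto simp: cinner_scaleC_left ee)
            then show ?thesis using that by simp
          qed
          have "cinner ?y ?y = (\<Sum>\<alpha>\<in>?V. cnj (of_real r * cinner x (e (i # \<alpha>))) * cinner ?y (e \<alpha>))"
            by (subst (2) y) (simp add: cinner_sum_right cinner_scaleC_right)
          also have "\<dots> = (\<Sum>\<alpha>\<in>?V. of_real (r\<^sup>2 * (cmod (cinner x (e (i # \<alpha>))))\<^sup>2))"
            by (intro sum.cong refl, subst ye)
              (auto simp: complex_norm_square power2_eq_square[of r] mult.commute simp del: of_real_power)
          finally have "complex_of_real ((norm ?y)\<^sup>2) =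
              of_real (r\<^sup>2 * (\<Sum>\<alpha>\<in>?V. (cmod (cinner x (e (i # \<alpha>))))\<^sup>2))"
            by (simp add: cinner_self sum_distrib_left)
          then show ?thesis using of_real_eq_iff by blast
        qed
        then have "(\<Sum>i\<in>UNIV. (norm (adj (S i) x))\<^sup>2) =
            r\<^sup>2 * (\<Sum>i\<in>UNIV. \<Sum>\<alpha>\<in>?V. (cmod (cinner x (e (i # \<alpha>))))\<^sup>2)"
          by (simp add: sum_distrib_left)
        also have "(\<Sum>i\<in>UNIV. \<Sum>\<alpha>\<in>?V. (cmod (cinner x (e (i # \<alpha>))))\<^sup>2) =
            (\<Sum>\<beta>\<in>(\<lambda>(i, \<alpha>). i # \<alpha>) ` (UNIV \<times> ?V). (cmod (cinner x (e \<beta>)))\<^sup>2)"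
          by (subst sum.reindex) (auto simp: inj_on_def sum.cartesian_product case_prod_unfold)
        also have "\<dots> \<le> (\<Sum>\<beta>\<in>?W. (cmod (cinner x (e \<beta>)))\<^sup>2)"
          by (intro sum_mono2) auto
        also have "\<dots> = (\<Sum>f\<in>E. (cmod (cinner x f))\<^sup>2)"
          unfolding eim[symmetric] by (subst sum.reindex[OF einj]) simp
        also have "\<dots> \<le> (norm x)\<^sup>2" by (rule bessel[OF E(1,3)])
        finally show "(\<Sum>i\<in>UNIV. (norm (adj (S i) x))\<^sup>2) \<le> (r * norm x)\<^sup>2"
          by (simp add: power_mult_distrib mult_left_mono)
      qed (use r in auto)
      then show ?thesis using SB r by (auto simp: row_ball_def)
    qed
    have word_h: "cinner (word_op S \<gamma> h) h =
        (if length \<gamma> \<le> N then of_real (r ^ length \<gamma>) *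
          (\<Sum>\<alpha> | length \<alpha> \<le> N - length \<gamma>. c \<alpha> * cnj (c (\<gamma> @ \<alpha>))) else 0)" for \<gamma>
    proof -
      have he: "cinner (e \<beta>) h = cnj (c \<beta>)" if "length \<beta> \<le> N" for \<beta>
      proof -
        have "cinner (e \<beta>) h = (\<Sum>\<alpha>\<in>?W. if \<alpha> = \<beta> then cnj (c \<alpha>) else 0)"
          unfolding h_def cinner_sum_right using that
          by (intro sum.cong) (auto simp: cinner_scaleC_right ee)
        then show ?thesis using that by simp
      qed
      have "word_op S \<gamma> h = (\<Sum>\<alpha>\<in>?W. c \<alpha> *\<^sub>C word_op S \<gamma> (e \<alpha>))"
        by (simp add: h_def blinfun.sum_right BH_D[OF word_op_in_BH[OF SB]])
      then have "cinner (word_op S \<gamma> h) h = (\<Sum>\<alpha>\<in>?W. c \<alpha> * cinner (word_op S \<gamma> (e \<alpha>)) h)"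
        by (simp add: cinner_sum_left cinner_scaleC_left)
      also have "\<dots> = (\<Sum>\<alpha>\<in>?W. if length \<gamma> + length \<alpha> \<le> N
            then of_real (r ^ length \<gamma>) * (c \<alpha> * cnj (c (\<gamma> @ \<alpha>))) else 0)"
        by (intro sum.cong refl) (auto simp: word_e cinner_scaleR_left he)
      also have "\<dots> = (\<Sum>\<alpha>\<in>{\<alpha>\<in>?W. length \<gamma> + length \<alpha> \<le> N}.
            of_real (r ^ length \<gamma>) * (c \<alpha> * cnj (c (\<gamma> @ \<alpha>))))"
        by (simp add: sum.If_cases Int_def)
      also have "{\<alpha>\<in>?W. length \<gamma> + length \<alpha> \<le> N} =
          (if length \<gamma> \<le> N then {\<alpha>. length \<alpha> \<le> N - length \<gamma>} else {})" by auto
      finally show ?thesis by (simp add: sum_distrib_left)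
    qed
    have hom: "cinner (homogeneous_part a S k h) h = (if k \<le> N then of_real (r ^ k) * p k else 0)" for k
    proof -
      have "cinner (homogeneous_part a S k h) h =
          (\<Sum>\<gamma> | length \<gamma> = k. a \<gamma> * cinner (word_op S \<gamma> h) h)"
        by (simp add: homogeneous_part_def blinfun.sum_left cinner_sum_left cinner_scaleC_left)
      also have "\<dots> = (\<Sum>\<gamma> | length \<gamma> = k. if k \<le> N then of_real (r ^ k) *
          (\<Sum>\<alpha> | length \<alpha> \<le> N - k. a \<gamma> * (c \<alpha> * cnj (c (\<gamma> @ \<alpha>)))) else 0)"
        by (intro sum.cong refl) (auto simp: word_h sum_distrib_left mult_ac)
      finally show ?thesis by (simp add: p_def sum_distrib_left)
    qed
    have "(\<lambda>k. cinner (homogeneous_part a S k h) h) sums cinner (G S h) h"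
      by (intro bounded_linear.sums[OF bounded_linear_cinner_left]
          bounded_linear.sums[OF blinfun.bounded_linear_left] homogeneous_part_sums[OF hol S_ball])
    moreover have "(\<lambda>k. cinner (homogeneous_part a S k h) h) sums (\<Sum>j\<le>N. cinner (homogeneous_part a S j h) h)"
      by (rule sums_finite) (auto simp: hom)
    ultimately have "cinner (G S h) h = (\<Sum>j\<le>N. of_real (r ^ j) * p j)"
      using sums_unique2 by (fastforce simp: hom)
    then show ?thesis using Re_cinner_nonneg_on_ball[OF hol pos S_ball] by metis
  qed
  \<comment> \<open>\<open>r = 1\<close> itself is excluded because the row norm of \<open>S\<close> can then be \<open>1\<close>\<close>
  have "((\<lambda>r. Re (\<Sum>j\<le>N. of_real (r ^ j) * p j)) \<longlongrightarrow> Re (\<Sum>j\<le>N. of_real (1 ^ j) * p j)) (at_left (1::real))"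
    by (intro tendsto_intros)
  moreover have "eventually (\<lambda>r::real. 0 < r \<and> r < 1) (at_left 1)"
    using eventually_at_left_real[of 0 1] by auto
  then have "eventually (\<lambda>r. 0 \<le> Re (\<Sum>j\<le>N. of_real (r ^ j) * p j)) (at_left (1::real))"
    by eventually_elim (use pos_r in blast)
  ultimately have "0 \<le> Re (\<Sum>j\<le>N. of_real (1 ^ j) * p j)"
    by (rule tendsto_lowerbound) auto
  then show ?thesis by (simp add: p_def)
qed

text \<open>
  The same positivity for vectors: by Parseval, the Gram matrix of the finitely many \<open>c \<alpha>\<close> that
  occur is a sum of rank one matrices, and each summand is the scalar inequality.
\<close>

lemma (in positive_form) toeplitz_kernel:
  fixes G :: "('n::finite \<Rightarrow> 'a bop) \<Rightarrow> 'a bop"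
  assumes "infinite_dimensional TYPE('a)" "free_holomorphic_with a G" "Re_positive_on_ball G"
  shows "0 \<le> Re (\<Sum>j\<le>N. \<Sum>\<gamma> | length \<gamma> = j. \<Sum>\<alpha> | length \<alpha> \<le> N - j.
                  a \<gamma> * B (c \<alpha>) (c (\<gamma> @ \<alpha>)))"
proof -
  obtain E where E: "finite E" and ex: "\<And>\<alpha>. length \<alpha> \<le> N \<Longrightarrow> c \<alpha> = expand E (c \<alpha>)"
    using gram_schmidt[of "c ` {\<alpha> :: 'n list. length \<alpha> \<le> N}"] by auto
  have "(\<Sum>j\<le>N. \<Sum>\<gamma> | length \<gamma> = j. \<Sum>\<alpha> | length \<alpha> \<le> N - j. a \<gamma> * B (c \<alpha>) (c (\<gamma> @ \<alpha>)))
      = (\<Sum>j\<le>N. \<Sum>\<gamma> | length \<gamma> = j. \<Sum>\<alpha> | length \<alpha> \<le> N - j. \<Sum>e\<in>E.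
          a \<gamma> * (B (c \<alpha>) e * cnj (B (c (\<gamma> @ \<alpha>)) e)))"
    by (intro sum.cong refl) (simp add: parseval[OF ex] sum_distrib_left)
  also have "\<dots> = (\<Sum>e\<in>E. \<Sum>j\<le>N. \<Sum>\<gamma> | length \<gamma> = j. \<Sum>\<alpha> | length \<alpha> \<le> N - j.
          a \<gamma> * (B (c \<alpha>) e * cnj (B (c (\<gamma> @ \<alpha>)) e)))"
    by (simp only: sum.swap[where B = E])
  also have "Re \<dots> \<ge> 0"
    unfolding Re_sum[where s = E] by (intro sum_nonneg toeplitz_kernel_scalar[OF assms])
  finally show ?thesis .
qed

section \<open>Neumann series and inverses\<close>

lemma inv_op_eqI: "inv_op T = S" if "is_inverse_op T S"
proof -
  have "S' = S" if "is_inverse_op T S'" for S'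
  proof -
    have "S' = S' o\<^sub>L (T o\<^sub>L S)" using \<open>is_inverse_op T S\<close> by (auto simp: is_inverse_op_def intro!: blinfun_eqI)
    also have "\<dots> = (S' o\<^sub>L T) o\<^sub>L S" by (rule blinfun_eqI) simp
    also have "\<dots> = S" using that by (auto simp: is_inverse_op_def intro!: blinfun_eqI)
    finally show ?thesis .
  qed
  with that show ?thesis unfolding inv_op_def by blast
qed

text \<open>
  The series is summed pointwise. The bound on its partial sums, uniform in their length, is the
  majorant for the later passage to the limit.
\<close>

lemma neumann_inverse:
  fixes T :: "'a::chilbert_space bop"
  assumes T: "T \<in> BH" "norm T < 1"
  obtains R where "is_inverse_op (id_blinfun - T) R"
    and "\<And>u. (\<lambda>i. (blinfun_apply T ^^ i) u) sums R u"
    and "\<And>u m. norm (\<Sum>i\<le>m. (blinfun_apply T ^^ i) u) \<le> norm u / (1 - norm T)"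
proof -
  have pw: "norm ((blinfun_apply T ^^ i) u) \<le> norm T ^ i * norm u" for i u
  proof (induction i)
    case (Suc i)
    have "norm ((blinfun_apply T ^^ Suc i) u) \<le> norm T * norm ((blinfun_apply T ^^ i) u)"
      by (simp add: norm_blinfun)
    also have "\<dots> \<le> norm T * (norm T ^ i * norm u)" by (intro mult_left_mono Suc) auto
    finally show ?case by (simp add: mult.assoc)
  qed simp
  have geo: "summable (\<lambda>i. norm T ^ i * norm u)" for u
    using T by (intro summable_mult2 summable_geometric) simp
  have sm: "summable (\<lambda>i. (blinfun_apply T ^^ i) u)" for u
    by (rule summable_comparison_test'[OF geo pw])
  define s where "s u = (\<Sum>i. (blinfun_apply T ^^ i) u)" for u
  have s_sums: "(\<lambda>i. (blinfun_apply T ^^ i) u) sums s u" for u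
    unfolding s_def by (rule summable_sums[OF sm])
  have s_eq: "s u - T (s u) = u" for u
  proof -
    have "(\<lambda>i. (blinfun_apply T ^^ Suc i) u) sums T (s u)"
      using bounded_linear.sums[OF blinfun.bounded_linear_right s_sums] by simp
    then have "(\<lambda>i. (blinfun_apply T ^^ i) u) sums (T (s u) + (blinfun_apply T ^^ 0) u)"
      by (rule sums_Suc)
    from sums_unique2[OF this s_sums] show ?thesis by (simp add: algebra_simps)
  qed
  have low: "(1 - norm T) * norm x \<le> norm (x - T x)" for x
  proof -
    have "norm x \<le> norm (x - T x) + norm (T x)" using norm_triangle_sub[of x "T x"] by simp
    then show ?thesis using norm_blinfun[of T x] by (simp add: algebra_simps)
  qed
  have inj: "x = y" if "x - T x = y - T y" for x y
  proof -
    have "(1 - norm T) * norm (x - y) \<le> 0"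
      using low[of "x - y"] that by (simp add: blinfun.diff_right algebra_simps)
    then have "norm (x - y) \<le> 0" using T(2) by (simp add: mult_le_0_iff)
    then show ?thesis by simp
  qed
  have sC: "s (c *\<^sub>C x) = c *\<^sub>C s x" for c x
    by (rule inj) (simp add: s_eq BH_D[OF T(1)] flip: complex_vector.scale_right_diff_distrib)
  have "bounded_linear s"
  proof (rule bounded_linear_intro)
    show "s (x + y) = s x + s y" for x y
    proof (rule inj)
      have "s x + s y - T (s x + s y) = (s x - T (s x)) + (s y - T (s y))"
        by (simp add: blinfun.add_right)
      then show "s (x + y) - T (s (x + y)) = s x + s y - T (s x + s y)" by (simp add: s_eq)
    qed
    show "s (r *\<^sub>R x) = r *\<^sub>R s x" for r x
      using sC[of "of_real r" x] by (simp add: scaleC_of_real)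
    show "norm (s x) \<le> norm x * (1 / (1 - norm T))" for x
      using low[of "s x"] T(2) by (simp add: s_eq pos_le_divide_eq mult.commute)
  qed
  then have R: "blinfun_apply (Blinfun s) = s" by (rule bounded_linear_Blinfun_apply)
  show ?thesis
  proof
    show "is_inverse_op (id_blinfun - T) (Blinfun s)"
      unfolding is_inverse_op_def
    proof (intro conjI)
      show "Blinfun s \<in> BH" by (simp add: BH_def R sC)
      show "(id_blinfun - T) o\<^sub>L Blinfun s = id_blinfun"
        by (rule blinfun_eqI) (simp add: R blinfun.diff_left s_eq)
      show "Blinfun s o\<^sub>L (id_blinfun - T) = id_blinfun"
        by (rule blinfun_eqI) (simp add: R blinfun.diff_left inj[OF s_eq])
    qed
    show "(\<lambda>i. (blinfun_apply T ^^ i) u) sums Blinfun s u" for u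
      using s_sums by (simp add: R)
    show "norm (\<Sum>i\<le>m. (blinfun_apply T ^^ i) u) \<le> norm u / (1 - norm T)" for u m
    proof -
      have "norm (\<Sum>i\<le>m. (blinfun_apply T ^^ i) u) \<le> (\<Sum>i\<le>m. norm T ^ i * norm u)"
        by (intro sum_norm_le pw)
      also have "\<dots> \<le> (\<Sum>i. norm T ^ i * norm u)"
        by (intro sum_le_suminf geo) auto
      also have "\<dots> = norm u / (1 - norm T)"
        using T(2) by (simp add: suminf_geometric flip: suminf_mult2)
      finally show ?thesis .
    qed
  qed
qed

section \<open>Summability of the homogeneous parts\<close>

lemma adj_scaleR: "T \<in> BH \<Longrightarrow> adj (r *\<^sub>R T) = r *\<^sub>R adj T" for T :: "'a::chilbert_space bop"
  by (intro adj_eqI scaleR_in_BH adj_in_BH)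
    (simp_all add: blinfun.scaleR_left cinner_scaleR_left cinner_scaleR_right cinner_adj)

lemma adj_scale_op: "T \<in> BH \<Longrightarrow> adj (scale_op c T) = scale_op (cnj c) (adj T)"
  by (intro adj_eqI scale_in_BH adj_in_BH)
    (simp_all add: cinner_scaleC_left cinner_scaleC_right cinner_adj)

text \<open>
  The tuple \<open>s X\<close> is still in the ball for some \<open>s > 1\<close>; convergence there bounds the
  homogeneous parts at \<open>X\<close> by a geometric sequence.
\<close>

lemma homogeneous_part_summable:
  fixes G :: "('n::finite \<Rightarrow> ('a::chilbert_space) bop) \<Rightarrow> 'a bop" and X :: "'n \<Rightarrow> 'a bop"
  assumes hol: "free_holomorphic_with a G" and X: "X \<in> row_ball"
  shows "summable (\<lambda>k. norm (homogeneous_part a X k))"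
proof -
  have XB: "\<And>i. X i \<in> BH" and rho: "row_norm X < 1" using X by (auto simp: row_ball_def)
  \<comment> \<open>any factor strictly between \<open>1\<close> and \<open>1 / row_norm X\<close>, written so that row norm \<open>0\<close> is covered\<close>
  define s where "s = 2 / (1 + row_norm X)"
  have s: "s > 1" "s * row_norm X < 1"
    using rho row_norm_nonneg[of X] by (auto simp: s_def field_simps)
  define X' where "X' i = s *\<^sub>R X i" for i
  have XB': "\<And>i. X' i \<in> BH" by (simp add: X'_def scaleR_in_BH XB)
  have "row_norm X' \<le> s * row_norm X"
  proof (rule row_norm_le[OF XB'])
    show "(\<Sum>i\<in>UNIV. (norm (adj (X' i) x))\<^sup>2) \<le> (s * row_norm X * norm x)\<^sup>2" for x
      using mult_left_mono[OF sum_norm_adj_le[of X x, OF XB], of "s\<^sup>2"]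
      by (simp add: X'_def adj_scaleR XB blinfun.scaleR_left power_mult_distrib sum_distrib_left mult.assoc)
  qed (use s row_norm_nonneg[of X] in auto)
  then have ball: "X' \<in> row_ball" using XB' s by (auto simp: row_ball_def)
  have "homogeneous_part a X' \<longlonglongrightarrow> 0"
    by (rule summable_LIMSEQ_zero[OF sums_summable[OF homogeneous_part_sums[OF hol ball]]])
  then have "Bseq (homogeneous_part a X')"
    using convergent_imp_Bseq convergentI by blast
  then obtain K where K: "\<And>k. norm (homogeneous_part a X' k) \<le> K" by (auto simp: Bseq_def)
  have word: "word_op X' \<alpha> x = s ^ length \<alpha> *\<^sub>R word_op X \<alpha> x" for \<alpha> x
    by (induction \<alpha>) (simp_all add: X'_def blinfun.scaleR_left blinfun.scaleR_right mult.commute)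
  have hom: "homogeneous_part a X' k = s ^ k *\<^sub>R homogeneous_part a X k" for k
    unfolding homogeneous_part_def scaleR_sum_right
    by (intro sum.cong[OF refl] blinfun_eqI) (simp add: word blinfun.scaleR_left scaleC_scaleR_commute)
  have le: "norm (norm (homogeneous_part a X k)) \<le> K * (1 / s) ^ k" for k
    using K[of k] s(1) by (simp add: hom power_one_over pos_le_divide_eq mult.commute)
  have "summable (\<lambda>k. K * (1 / s) ^ k)"
    using s(1) by (intro summable_mult summable_geometric) auto
  then show ?thesis using le by (rule summable_comparison_test')
qed

definition monomial :: "complex ^ 'n::finite \<Rightarrow> 'n list \<Rightarrow> complex" where
  "monomial z \<alpha> = prod_list (map (\<lambda>i. z $ i) \<alpha>)"

lemma monomial_simps [simp]:
  "monomial z [] = 1" "monomial z (i # \<alpha>) = z $ i * monomial z \<alpha>"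
  "monomial z (\<gamma> @ \<alpha>) = monomial z \<gamma> * monomial z \<alpha>"
  by (simp_all add: monomial_def)

lemma sum_norm_components: "(\<Sum>i\<in>UNIV. (cmod (z $ i))\<^sup>2) = (norm z)\<^sup>2"
  for z :: "complex ^ 'n::finite"
  by (simp add: norm_vec_def L2_set_def sum_nonneg)

lemma infinite_dimensional_nonzero:
  assumes "infinite_dimensional TYPE('a::chilbert_space)"
  obtains x :: "'a::chilbert_space" where "x \<noteq> 0"
proof -
  have "finite {0 :: 'a}" by simp
  then have "complex_vector.span {0 :: 'a} \<noteq> UNIV"
    using assms unfolding infinite_dimensional_def by blast
  then show ?thesis using that by (metis UNIV_eq_I complex_vector.span_zero)
qed

text \<open>
  At the scalar tuple \<open>z\<^sub>i I\<close> a homogeneous part is a scalar multiple of the identity, so the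
  previous lemma applies.
\<close>

lemma scalar_homogeneous_part_summable:
  fixes G :: "('n::finite \<Rightarrow> ('a::chilbert_space) bop) \<Rightarrow> 'a bop"
  assumes inf: "infinite_dimensional TYPE('a)"
    and hol: "free_holomorphic_with a G" and z: "norm z < 1"
  shows "summable (\<lambda>k. cmod (\<Sum>\<alpha> | length \<alpha> = k. a \<alpha> * monomial z \<alpha>))"
proof -
  obtain x :: 'a where x: "x \<noteq> 0" using infinite_dimensional_nonzero[OF inf] by blast
  define Z :: "'n \<Rightarrow> 'a bop" where "Z i = scale_op (z $ i) id_blinfun" for i
  have ZB: "\<And>i. Z i \<in> BH" by (simp add: Z_def scale_in_BH)
  have "row_norm Z \<le> norm z"
  proof (rule row_norm_le[OF ZB])
    show "(\<Sum>i\<in>UNIV. (norm (adj (Z i) x))\<^sup>2) \<le> (norm z * norm x)\<^sup>2" for x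
      by (simp add: Z_def adj_scale_op adj_id norm_scaleC power_mult_distrib sum_norm_components
          flip: sum_distrib_right)
  qed auto
  then have Zb: "Z \<in> row_ball" using ZB z by (auto simp: row_ball_def)
  have word: "word_op Z \<alpha> y = monomial z \<alpha> *\<^sub>C y" for \<alpha> y
    by (induction \<alpha>) (simp_all add: Z_def scaleC_scaleC scaleC_one)
  have "cmod (\<Sum>\<alpha> | length \<alpha> = k. a \<alpha> * monomial z \<alpha>) \<le> norm (homogeneous_part a Z k)" for k
  proof -
    have "homogeneous_part a Z k x = (\<Sum>\<alpha> | length \<alpha> = k. a \<alpha> * monomial z \<alpha>) *\<^sub>C x"
      by (simp add: homogeneous_part_def blinfun.sum_left word scaleC_scaleC complex_vector.scale_sum_left)
    then have "cmod (\<Sum>\<alpha> | length \<alpha> = k. a \<alpha> * monomial z \<alpha>) * norm x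
        \<le> norm (homogeneous_part a Z k) * norm x"
      using norm_blinfun[of "homogeneous_part a Z k" x] by (simp add: norm_scaleC)
    then show ?thesis using x by simp
  qed
  then show ?thesis
    by (intro summable_comparison_test'[OF homogeneous_part_summable[OF hol Zb]]) auto
qed

section \<open>Sums over words\<close>

lemma sum_words_Suc:
  "(\<Sum>\<alpha> | length \<alpha> = Suc m. f \<alpha>) = (\<Sum>i\<in>UNIV. \<Sum>\<alpha> | length \<alpha> = m. f (i # \<alpha>))"
  for f :: "'n::finite list \<Rightarrow> 'b::comm_monoid_add"
proof -
  have "{\<alpha> :: 'n list. length \<alpha> = Suc m} = (\<lambda>(i, \<alpha>). i # \<alpha>) ` (UNIV \<times> {\<alpha>. length \<alpha> = m})"
    by (auto simp: length_Suc_conv)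
  then show ?thesis
    by (simp add: sum.reindex inj_on_def sum.cartesian_product case_prod_unfold)
qed

lemma sum_words_le:
  "(\<Sum>\<alpha> | length \<alpha> \<le> m. f \<alpha>) = (\<Sum>k\<le>m. \<Sum>\<alpha> | length \<alpha> = k. f \<alpha>)"
  for f :: "'n::finite list \<Rightarrow> 'b::comm_monoid_add"
proof -
  have "(\<Sum>k\<le>m. \<Sum>\<alpha> | length \<alpha> = k. f \<alpha>) =
      (\<Sum>k\<le>m. sum f {\<alpha> \<in> {\<alpha>. length \<alpha> \<le> m}. length \<alpha> = k})"
    by (intro sum.cong) auto
  also have "\<dots> = (\<Sum>\<alpha> | length \<alpha> \<le> m. f \<alpha>)" by (rule sum.group) auto
  finally show ?thesis by simp
qed

lemma sum_monomial_squares: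
  "(\<Sum>\<alpha> | length \<alpha> = m. monomial z \<alpha> * cnj (monomial z \<alpha>)) = of_real (((norm z)\<^sup>2) ^ m)"
proof (induction m)
  case (Suc m)
  have "(\<Sum>\<alpha> | length \<alpha> = Suc m. monomial z \<alpha> * cnj (monomial z \<alpha>)) =
      (\<Sum>i\<in>UNIV. z $ i * cnj (z $ i)) * (\<Sum>\<alpha> | length \<alpha> = m. monomial z \<alpha> * cnj (monomial z \<alpha>))"
    by (simp add: sum_words_Suc sum_product mult_ac)
  also have "(\<Sum>i\<in>UNIV. z $ i * cnj (z $ i)) = of_real ((norm z)\<^sup>2)"
    unfolding sum_norm_components[symmetric] of_real_sum complex_norm_square ..
  finally show ?case by (simp add: Suc)
qed simp

section \<open>A strict row contraction\<close>

text \<open>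
  Cauchy--Schwarz for the pairing of \<open>z\<close> with the column \<open>(X\<^sub>i\<^sup>* y)\<^sub>i\<close>, whose norm is at most
  \<open>row_norm X * norm y\<close>.
\<close>

lemma norm_row_vec_le:
  assumes XB: "\<And>i. X i \<in> BH"
  shows "norm (row_vec X z) \<le> row_norm X * norm z"
proof (rule norm_blinfun_bound)
  fix x
  let ?y = "row_vec X z x"
  have "(norm ?y)\<^sup>2 = cmod (cinner ?y ?y)" by (simp add: cinner_self norm_power)
  also have "cinner ?y ?y = (\<Sum>i\<in>UNIV. cnj (z $ i) * cinner x (adj (X i) ?y))"
    by (subst (1) row_vec_def)
      (simp add: blinfun.sum_left cinner_sum_left cinner_scaleC_left cinner_adj[OF XB])
  also have "cmod \<dots> \<le> (\<Sum>i\<in>UNIV. (cmod (z $ i) * norm x) * norm (adj (X i) ?y))"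
    by (intro sum_norm_le) (simp add: norm_mult mult.assoc mult_left_mono cmod_cinner_le)
  also have "\<dots> \<le> (norm z * norm x) * (row_norm X * norm ?y)"
    by (intro sum_mult_le_of_sum_squares sum_norm_adj_le[OF XB])
      (auto simp: power_mult_distrib sum_norm_components row_norm_nonneg simp flip: sum_distrib_right)
  finally have "norm ?y * norm ?y \<le> (row_norm X * norm z * norm x) * norm ?y"
    by (simp add: power2_eq_square ac_simps)
  then show "norm ?y \<le> row_norm X * norm z * norm x"
    by (cases "norm ?y = 0") (auto simp: row_norm_nonneg)
qed (simp add: row_norm_nonneg)

lemma row_vec_in_BH: "(\<And>i. X i \<in> BH) \<Longrightarrow> row_vec X z \<in> BH"
  unfolding row_vec_def by (intro sum_in_BH scale_in_BH)

lemma adj_row_vec: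
  assumes XB: "\<And>i. X i \<in> BH"
  shows "adj (row_vec X z) = vec_row z X"
proof (rule adj_eqI)
  show "vec_row z X \<in> BH"
    unfolding vec_row_def by (intro sum_in_BH scale_in_BH adj_in_BH XB)
  show "cinner (row_vec X z x) y = cinner x (vec_row z X y)" for x y
    by (simp add: row_vec_def vec_row_def blinfun.sum_left cinner_sum_left cinner_sum_right
        cinner_scaleC_left cinner_scaleC_right cinner_adj[OF XB])
qed

locale strict_row_contraction =
  fixes X :: "'n::finite \<Rightarrow> ('a::chilbert_space) bop"
  assumes in_row_ball: "X \<in> row_ball"
begin

lemma XB: "X i \<in> BH" and row_norm_less_1: "row_norm X < 1"
  using in_row_ball by (auto simp: row_ball_def)

definition defect :: "'a bop" where
  "defect = id_blinfun - row_sq X"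

text \<open>
  The kernel inequality is tested in this inner product; measuring vectors with \<open>I - X X\<^sup>*\<close> makes
  sums over words telescope.
\<close>

definition defect_form :: "'a \<Rightarrow> 'a \<Rightarrow> complex" where
  "defect_form x y = cinner (defect x) y"

lemma defect_form_eq:
  "defect_form x y = cinner x y - (\<Sum>i\<in>UNIV. cinner (adj (X i) x) (adj (X i) y))"
  by (simp add: defect_form_def defect_def blinfun.diff_left cinner_diff_left cinner_row_sq[OF XB])

sublocale defect: positive_form defect_form
proof
  show "defect_form (x + y) w = defect_form x w + defect_form y w" for x y w
    by (simp add: defect_form_def blinfun.add_right cinner_add_left)
  show "defect_form (c *\<^sub>C x) w = c * defect_form x w" for c x w
    by (simp add: defect_form_eq BH_D[OF adj_in_BH[OF XB]] cinner_scaleC_left sum_distrib_left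
        algebra_simps)
  show "defect_form x y = cnj (defect_form y x)" for x y
    by (simp add: defect_form_eq flip: cinner_commute)
  show "Re (defect_form x x) > 0" if "x \<noteq> 0" for x
  proof -
    have "(\<Sum>i\<in>UNIV. (norm (adj (X i) x))\<^sup>2) \<le> (row_norm X * norm x)\<^sup>2"
      by (rule sum_norm_adj_le[OF XB])
    also have "\<dots> < (1 * norm x)\<^sup>2"
      using row_norm_less_1 row_norm_nonneg[of X] that
      by (intro power_strict_mono mult_strict_right_mono) auto
    finally show ?thesis by (simp add: defect_form_eq cinner_self)
  qed
qed

definition adj_word :: "'n list \<Rightarrow> 'a bop" where
  "adj_word \<alpha> = adj (word_op X \<alpha>)"

lemma adj_word_simps [simp]:
  "adj_word [] = id_blinfun" "adj_word (i # \<alpha>) x = adj_word \<alpha> (adj (X i) x)" "adj_word (\<gamma> @ \<alpha>) x = adj_word \<alpha> (adj_word \<gamma> x)"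
  by (simp_all add: adj_word_def adj_id adj_compose word_op_append XB word_op_in_BH)

lemma adj_word_scaleC: "adj_word \<alpha> (c *\<^sub>C x) = c *\<^sub>C adj_word \<alpha> x"
  unfolding adj_word_def by (intro BH_D adj_in_BH word_op_in_BH XB)

text \<open>
  This is \<open>\<langle>\<Phi>\<^sup>m(I) x, y\<rangle>\<close> for the completely positive map \<open>\<Phi>(Q) = \<Sum>\<^sub>i X\<^sub>i Q X\<^sub>i\<^sup>*\<close>; it is the error made
  by cutting off the sum over words.
\<close>

definition tail_form :: "nat \<Rightarrow> 'a \<Rightarrow> 'a \<Rightarrow> complex" where
  "tail_form m x y = (\<Sum>\<alpha> | length \<alpha> = m. cinner (adj_word \<alpha> x) (adj_word \<alpha> y))"

lemma tail_form_0: "tail_form 0 x y = cinner x y"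
  by (simp add: tail_form_def)

lemma tail_form_Suc: "tail_form (Suc m) x y = (\<Sum>i\<in>UNIV. tail_form m (adj (X i) x) (adj (X i) y))"
  by (simp add: tail_form_def sum_words_Suc)

lemma tail_form_bound: "cmod (tail_form m x y) \<le> ((row_norm X)\<^sup>2) ^ m * (norm x * norm y)"
proof (induction m arbitrary: x y)
  case 0
  then show ?case by (simp add: tail_form_0 cmod_cinner_le)
next
  case (Suc m)
  have "cmod (tail_form (Suc m) x y) \<le>
      (\<Sum>i\<in>UNIV. ((row_norm X)\<^sup>2) ^ m * (norm (adj (X i) x) * norm (adj (X i) y)))"
    unfolding tail_form_Suc by (intro sum_norm_le Suc)
  also have "\<dots> \<le> ((row_norm X)\<^sup>2) ^ m * ((row_norm X * norm x) * (row_norm X * norm y))"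
    unfolding sum_distrib_left[symmetric]
    by (intro mult_left_mono sum_mult_le_of_sum_squares sum_norm_adj_le XB)
      (auto simp: row_norm_nonneg)
  finally show ?case by (simp add: power2_eq_square ac_simps)
qed

lemma tail_form_le_norm: "cmod (tail_form m x y) \<le> norm x * norm y"
proof -
  have "((row_norm X)\<^sup>2) ^ m \<le> 1"
    using row_norm_less_1 row_norm_nonneg[of X] by (intro power_le_one) (auto simp: power_le_one)
  then have "((row_norm X)\<^sup>2) ^ m * (norm x * norm y) \<le> 1 * (norm x * norm y)"
    by (intro mult_right_mono) auto
  with tail_form_bound[of m x y] show ?thesis by simp
qed

lemma tail_form_tendsto_0: "(\<lambda>m. tail_form m x y) \<longlonglongrightarrow> 0"
proof (rule Lim_null_comparison[OF always_eventually[OF allI[OF tail_form_bound]]])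
  have "(row_norm X)\<^sup>2 < 1"
    using row_norm_less_1 row_norm_nonneg[of X] by (simp add: power_less_one_iff abs_square_less_1)
  then have "(\<lambda>m. ((row_norm X)\<^sup>2) ^ m) \<longlonglongrightarrow> 0" by (intro LIMSEQ_realpow_zero) auto
  from tendsto_mult_left_zero[OF this]
  show "(\<lambda>m. ((row_norm X)\<^sup>2) ^ m * (norm x * norm y)) \<longlonglongrightarrow> 0" .
qed

text \<open>
  For \<open>m = 0\<close> this is the definition of the defect; splitting off the first letter of the word
  propagates it. Summation over \<open>m\<close> will telescope.
\<close>

lemma defect_words:
  "(\<Sum>\<alpha> | length \<alpha> = m. defect_form (adj_word \<alpha> x) (adj_word \<alpha> y)) = tail_form m x y - tail_form (Suc m) x y"
proof (induction m arbitrary: x y)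
  case 0
  then show ?case by (simp add: tail_form_Suc tail_form_0 defect_form_eq)
next
  case (Suc m)
  then show ?case
    by (simp add: sum_words_Suc tail_form_Suc[of "Suc m"] sum_subtractf) (simp add: tail_form_Suc)
qed

lemma defect_words_le:
  "(\<Sum>\<alpha> | length \<alpha> \<le> m. defect_form (adj_word \<alpha> x) (adj_word \<alpha> y)) = cinner x y - tail_form (Suc m) x y"
proof -
  have "(\<Sum>k\<le>m. tail_form k x y - tail_form (Suc k) x y) = cinner x y - tail_form (Suc m) x y"
    by (subst sum_telescope) (simp add: tail_form_0)
  then show ?thesis by (simp add: sum_words_le defect_words)
qed

text \<open>
  Expanding the power of \<open>X z\<^sup>* = \<Sum>\<^sub>i cnj (z\<^sub>i) X\<^sub>i\<close> gives one term for each word of length \<open>m\<close>; moved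
  to the other side, the product of the \<open>X\<^sub>i\<close> becomes the adjoint of a word.
\<close>

lemma monomial_words:
  "(\<Sum>\<alpha> | length \<alpha> = m. cnj (monomial z \<alpha>) * cinner u (adj_word \<alpha> y)) =
     cinner ((blinfun_apply (row_vec X z) ^^ m) u) y"
proof (induction m arbitrary: y)
  case (Suc m)
  let ?v = "(blinfun_apply (row_vec X z) ^^ m) u"
  have "(\<Sum>\<alpha> | length \<alpha> = Suc m. cnj (monomial z \<alpha>) * cinner u (adj_word \<alpha> y)) =
      (\<Sum>i\<in>UNIV. cnj (z $ i) * (\<Sum>\<alpha> | length \<alpha> = m. cnj (monomial z \<alpha>) * cinner u (adj_word \<alpha> (adj (X i) y))))"
    by (simp add: sum_words_Suc sum_distrib_left mult.assoc)
  also have "\<dots> = (\<Sum>i\<in>UNIV. cnj (z $ i) * cinner ?v (adj (X i) y))"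
    by (simp only: Suc)
  also have "\<dots> = cinner (row_vec X z ?v) y"
    by (simp add: row_vec_def blinfun.sum_left cinner_sum_left cinner_scaleC_left cinner_adj[OF XB])
  finally show ?case by simp
qed simp

lemma monomial_words_le:
  "(\<Sum>\<alpha> | length \<alpha> \<le> m. cnj (monomial z \<alpha>) * cinner u (adj_word \<alpha> y)) =
     cinner (\<Sum>k\<le>m. (blinfun_apply (row_vec X z) ^^ k) u) y"
  by (simp add: sum_words_le monomial_words cinner_sum_left)

lemma row_vec_inverse:
  assumes "norm z \<le> 1"
  obtains R where "is_inverse_op (id_blinfun - row_vec X z) R"
    and "\<And>u. (\<lambda>i. (blinfun_apply (row_vec X z) ^^ i) u) sums R u"
    and "\<And>u m. norm (\<Sum>i\<le>m. (blinfun_apply (row_vec X z) ^^ i) u) \<le> norm u / (1 - row_norm X)"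
proof -
  have le: "norm (row_vec X z) \<le> row_norm X"
    using norm_row_vec_le[of X z, OF XB] mult_left_mono[OF assms row_norm_nonneg[of X]] by simp
  then have l1: "norm (row_vec X z) < 1" using row_norm_less_1 by simp
  obtain R where R: "is_inverse_op (id_blinfun - row_vec X z) R"
      "\<And>u. (\<lambda>i. (blinfun_apply (row_vec X z) ^^ i) u) sums R u"
      "\<And>u m. norm (\<Sum>i\<le>m. (blinfun_apply (row_vec X z) ^^ i) u) \<le> norm u / (1 - norm (row_vec X z))"
    using neumann_inverse[OF row_vec_in_BH[OF XB] l1] by metis
  have "norm u / (1 - norm (row_vec X z)) \<le> norm u / (1 - row_norm X)" for u :: 'a
    using le row_norm_less_1 by (intro divide_left_mono) auto
  with R(3) have "norm (\<Sum>i\<le>m. (blinfun_apply (row_vec X z) ^^ i) u) \<le> norm u / (1 - row_norm X)" for u m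
    by (meson order_trans)
  with R(1,2) show ?thesis using that by blast
qed

text \<open>
  This is a Schwarz--Pick inequality for the two points \<open>X\<close> and \<open>z\<close>. The Toeplitz inequality for
  the defect form is applied to the vectors \<open>c \<alpha> = X\<^sub>\<alpha>\<^sup>* h + cnj (z\<^sub>\<alpha>) v\<close>, with the sums cut off at \<open>N\<close>.
  The sum over \<open>\<alpha>\<close> of each of the four terms of \<open>defect_form (c \<alpha>) (c (\<gamma> @ \<alpha>))\<close> is explicit:
  a telescoping sum, two Neumann series for \<open>(I - X z\<^sup>*)\<^sup>-\<^sup>1\<close>, and a geometric series. The sum over
  \<open>\<gamma>\<close> then rebuilds \<open>G\<close> at \<open>X\<close> and at \<open>z\<close>, and \<open>N \<rightarrow> \<infinity>\<close> is taken under the sum over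
  \<open>length \<gamma>\<close> by dominated convergence.
\<close>

lemma two_point_pick:
  assumes inf: "infinite_dimensional TYPE('a)"
    and hol: "free_holomorphic_with a G" and pos: "Re_positive_on_ball G"
    and z: "norm z < 1"
    and w: "w - row_vec X z w = defect v"
  shows "0 \<le> Re (cinner (G X (h + w)) h +
      scalar_value a z * (cinner h w + defect_form v v / of_real (1 - (norm z)\<^sup>2)))"
proof -
  let ?T = "blinfun_apply (row_vec X z)"
  define u where "u = defect v"
  obtain R where R: "is_inverse_op (id_blinfun - row_vec X z) R"
      "(\<lambda>i. (?T ^^ i) u) sums R u"
    and Ub: "\<And>m. norm (\<Sum>i\<le>m. (?T ^^ i) u) \<le> norm u / (1 - row_norm X)"
    using row_vec_inverse[of z] z by (metis less_imp_le)
  have "R u = w"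
  proof -
    have "R u = (R o\<^sub>L (id_blinfun - row_vec X z)) w" by (simp add: u_def blinfun.diff_left flip: w)
    also have "\<dots> = id_blinfun w" using R(1) unfolding is_inverse_op_def by metis
    finally show ?thesis by simp
  qed
  define U where "U m = (\<Sum>i\<le>m. (?T ^^ i) u)" for m
  have U_lim: "U \<longlonglongrightarrow> w"
    using R(2) unfolding \<open>R u = w\<close> sums_def_le U_def[abs_def] .
  define s where "s m = (\<Sum>i\<le>m. of_real (((norm z)\<^sup>2) ^ i) :: complex)" for m
  define s' where "s' = 1 / (1 - (norm z)\<^sup>2)"
  have z2: "(norm z)\<^sup>2 < 1" using z by (simp add: abs_square_less_1)
  have gs: "(\<lambda>i. ((norm z)\<^sup>2) ^ i) sums s'"
    unfolding s'_def using z2 by (intro geometric_sums) simp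
  have s_lim: "s \<longlonglongrightarrow> of_real s'"
    using sums_of_real[OF gs] unfolding sums_def_le s_def[abs_def] by simp
  have s_bound: "cmod (s m) \<le> s'" for m
  proof -
    have "cmod (s m) = (\<Sum>i\<le>m. ((norm z)\<^sup>2) ^ i)"
      unfolding s_def of_real_sum[symmetric] norm_of_real by (simp add: sum_nonneg)
    also have "\<dots> \<le> s'"
      using gs by (auto simp: sums_iff intro!: sum_le_suminf)
    finally show ?thesis .
  qed
  define A where "A j = homogeneous_part a X j" for j
  \<comment> \<open>\<open>k j\<close> is the adjoint of the homogeneous part, applied to \<open>h\<close>\<close>
  define k where "k j = (\<Sum>\<gamma> | length \<gamma> = j. cnj (a \<gamma>) *\<^sub>C adj_word \<gamma> h)" for j
  define g where "g j = (\<Sum>\<gamma> | length \<gamma> = j. a \<gamma> * monomial z \<gamma>)" for j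
  have k: "cinner x (k j) = cinner (A j x) h" for x j
    unfolding k_def A_def homogeneous_part_def adj_word_def
    by (simp add: blinfun.sum_left cinner_sum_left cinner_sum_right cinner_scaleC_left
        cinner_scaleC_right cinner_adj[OF word_op_in_BH[OF XB]])
  have k_bound: "norm (k j) \<le> norm (A j) * norm h" for j
  proof (cases "k j = 0")
    case False
    have "norm (k j) * norm (k j) = cmod (cinner (A j (k j)) h)"
      unfolding k[symmetric] by (simp add: cinner_self norm_power power2_eq_square norm_mult)
    also have "\<dots> \<le> norm (A j (k j)) * norm h" by (rule cmod_cinner_le)
    also have "\<dots> \<le> norm (A j) * norm (k j) * norm h" by (intro mult_right_mono norm_blinfun) auto
    finally show ?thesis using False by (simp add: mult.commute mult.left_commute)
  qed simp
  define b where "b = defect_form v v"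
  define c where "c \<alpha> = adj_word \<alpha> h + cnj (monomial z \<alpha>) *\<^sub>C v" for \<alpha>
  define t where "t j m = (\<Sum>\<gamma> | length \<gamma> = j. \<Sum>\<alpha> | length \<alpha> \<le> m. a \<gamma> * defect_form (c \<alpha>) (c (\<gamma> @ \<alpha>)))" for j m
  have inner_sum: "(\<Sum>\<alpha> | length \<alpha> \<le> m. defect_form (c \<alpha>) (c (\<gamma> @ \<alpha>))) =
      cinner h (adj_word \<gamma> h) - tail_form (Suc m) h (adj_word \<gamma> h) + cinner (U m) (adj_word \<gamma> h)
      + monomial z \<gamma> * (cnj (cinner (U m) h) + s m * b)" for \<gamma> m
  proof -
    have "defect_form (c \<alpha>) (c (\<gamma> @ \<alpha>)) =
        defect_form (adj_word \<alpha> h) (adj_word \<alpha> (adj_word \<gamma> h)) + cnj (monomial z \<alpha>) * cinner u (adj_word \<alpha> (adj_word \<gamma> h))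
        + monomial z \<gamma> * (cnj (cnj (monomial z \<alpha>) * cinner u (adj_word \<alpha> h))
            + (monomial z \<alpha> * cnj (monomial z \<alpha>)) * b)" for \<alpha>
    proof -
      have "defect_form v y = cinner u y" for y by (simp add: defect_form_def u_def)
      moreover have "defect_form y v = cnj (cinner u y)" for y
        by (metis defect.hermitian defect_form_def u_def)
      ultimately show ?thesis
        by (simp add: c_def defect.add_left defect.add_right defect.scaleC_left defect.scaleC_right
            cinner_add_right cinner_scaleC_right b_def algebra_simps)
    qed
    moreover have "(\<Sum>\<alpha> | length \<alpha> \<le> m. cnj (cnj (monomial z \<alpha>) * cinner u (adj_word \<alpha> h))) = cnj (cinner (U m) h)"
      unfolding cnj_sum[symmetric] monomial_words_le U_def ..
    moreover have "(\<Sum>\<alpha> | length \<alpha> \<le> m. monomial z \<alpha> * cnj (monomial z \<alpha>)) = s m"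
      unfolding sum_words_le sum_monomial_squares s_def ..
    ultimately show ?thesis
      by (simp only: sum.distrib defect_words_le monomial_words_le flip: sum_distrib_left sum_distrib_right U_def)
  qed
  have t_eq: "t j m = cinner h (k j) - tail_form (Suc m) h (k j) + cinner (U m) (k j)
      + g j * (cnj (cinner (U m) h) + s m * b)" for j m
  proof -
    have "tail_form (Suc m) h (k j) = (\<Sum>\<gamma> | length \<gamma> = j. a \<gamma> * tail_form (Suc m) h (adj_word \<gamma> h))"
      unfolding tail_form_def k_def
      by (simp add: blinfun.sum_right adj_word_scaleC cinner_sum_right cinner_scaleC_right sum_distrib_left
          sum.swap[of _ "{\<alpha>. length \<alpha> = Suc m}"])
    moreover have "cinner x (k j) = (\<Sum>\<gamma> | length \<gamma> = j. a \<gamma> * cinner x (adj_word \<gamma> h))" for x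
      by (simp add: k_def cinner_sum_right cinner_scaleC_right)
    moreover have "t j m = (\<Sum>\<gamma> | length \<gamma> = j. a \<gamma> * (cinner h (adj_word \<gamma> h) - tail_form (Suc m) h (adj_word \<gamma> h)
        + cinner (U m) (adj_word \<gamma> h) + monomial z \<gamma> * (cnj (cinner (U m) h) + s m * b)))"
      unfolding t_def by (simp only: inner_sum flip: sum_distrib_left)
    ultimately show ?thesis
      unfolding g_def sum_distrib_right
      by (simp add: sum.distrib sum_subtractf distrib_left right_diff_distrib mult.assoc)
  qed
  define l where "l j = cinner h (k j) + cinner w (k j) + g j * (cinner h w + of_real s' * b)" for j
  have t_lim: "(\<lambda>m. t j m) \<longlonglongrightarrow> l j" for j
  proof -
    have "(\<lambda>m. tail_form (Suc m) h (k j)) \<longlonglongrightarrow> 0"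
      using tail_form_tendsto_0 by (rule LIMSEQ_Suc)
    then have "(\<lambda>m. t j m) \<longlonglongrightarrow> cinner h (k j) - 0 + cinner w (k j)
        + g j * (cnj (cinner w h) + of_real s' * b)"
      unfolding t_eq by (intro tendsto_intros tendsto_cinner_left U_lim s_lim)
    then show ?thesis by (simp add: l_def flip: cinner_commute)
  qed
  define K where "K = norm u / (1 - row_norm X)"
  define D where "D j = norm (A j) * (norm h * (norm h + norm h + K)) + cmod (g j) * (K * norm h + s' * cmod b)" for j
  have U_bound: "cmod (cinner (U m) y) \<le> K * norm y" for m y
    using order_trans[OF cmod_cinner_le mult_right_mono[OF Ub norm_ge_zero]]
    by (simp only: U_def K_def)
  have t_bound: "cmod (t j m) \<le> D j" for j m
  proof -
    have "cmod (cinner h (k j)) \<le> norm h * norm (k j)" by (rule cmod_cinner_le)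
    moreover have "cmod (tail_form (Suc m) h (k j)) \<le> norm h * norm (k j)" by (rule tail_form_le_norm)
    moreover have "cmod (cinner (U m) (k j)) \<le> K * norm (k j)" by (rule U_bound)
    moreover have "cmod (g j * (cnj (cinner (U m) h) + s m * b)) \<le> cmod (g j) * (K * norm h + s' * cmod b)"
    proof -
      have "cmod (cinner (U m) h) \<le> K * norm h" by (rule U_bound)
      moreover have "cmod (s m * b) \<le> s' * cmod b" by (simp add: norm_mult s_bound mult_right_mono)
      ultimately show ?thesis unfolding norm_mult[of "g j"]
        by (intro mult_left_mono norm_triangle_le) auto
    qed
    ultimately have "cmod (t j m) \<le> (norm h + norm h + K) * norm (k j) + cmod (g j) * (K * norm h + s' * cmod b)"
      unfolding t_eq distrib_right by (smt (verit) norm_triangle_ineq norm_triangle_ineq4)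
    also have "(norm h + norm h + K) * norm (k j) \<le> (norm h + norm h + K) * (norm (A j) * norm h)"
      using row_norm_less_1 by (intro mult_left_mono k_bound) (auto simp: K_def)
    finally show ?thesis by (simp add: D_def mult_ac)
  qed
  have gsum: "summable (\<lambda>j. cmod (g j))"
    unfolding g_def by (rule scalar_homogeneous_part_summable[OF inf hol z])
  have "summable D"
    unfolding D_def A_def
    by (intro summable_add summable_mult2 gsum homogeneous_part_summable[OF hol in_row_ball])
  moreover have "(\<lambda>N. if j \<le> N then t j (N - j) else 0) \<longlonglongrightarrow> l j" for j
  proof -
    have "(\<lambda>N. t j (N - j)) \<longlonglongrightarrow> l j"
      using filterlim_compose[OF t_lim filterlim_minus_const_nat_at_top] .
    moreover have "eventually (\<lambda>N. t j (N - j) = (if j \<le> N then t j (N - j) else 0)) sequentially"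
      using eventually_ge_at_top[of j] by eventually_elim simp
    ultimately show ?thesis by (rule Lim_transform_eventually)
  qed
  moreover have "eventually (\<lambda>(j, N). norm (if j \<le> N then t j (N - j) else 0) \<le> D j) (at_top \<times>\<^sub>F sequentially)"
  proof (intro always_eventually allI, clarify)
    fix j N
    show "norm (if j \<le> N then t j (N - j) else 0) \<le> D j"
      using t_bound[of j "N - j"] order_trans[OF norm_ge_zero t_bound] by auto
  qed
  ultimately have "(\<lambda>N. suminf (\<lambda>j. if j \<le> N then t j (N - j) else 0)) \<longlonglongrightarrow> suminf l"
    by (intro tannerys_theorem[THEN conjunct2, THEN conjunct2]) auto
  moreover have "suminf (\<lambda>j. if j \<le> N then t j (N - j) else 0) = (\<Sum>j\<le>N. t j (N - j))" for N
    by (subst suminf_finite[of "{..N}"]) auto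
  ultimately have lim: "(\<lambda>N. \<Sum>j\<le>N. t j (N - j)) \<longlonglongrightarrow> suminf l" by simp
  have "0 \<le> Re (\<Sum>j\<le>N. t j (N - j))" for N
    unfolding t_def by (rule defect.toeplitz_kernel[OF inf hol pos])
  then have "0 \<le> Re (suminf l)"
    by (intro tendsto_lowerbound[OF tendsto_Re[OF lim]] always_eventually allI) auto
  moreover have "l sums (cinner (G X (h + w)) h + scalar_value a z * (cinner h w + of_real s' * b))"
  proof -
    have "(\<lambda>j. cinner (A j (h + w)) h) sums cinner (G X (h + w)) h"
      unfolding A_def
      by (intro bounded_linear.sums[OF bounded_linear_cinner_left]
          bounded_linear.sums[OF blinfun.bounded_linear_left] homogeneous_part_sums[OF hol in_row_ball])
    moreover have "g sums scalar_value a z"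
      using summable_sums[OF summable_norm_cancel[OF gsum]]
      by (simp add: scalar_value_def g_def[abs_def] monomial_def)
    ultimately show ?thesis
      unfolding l_def k by (simp add: blinfun.add_right cinner_add_left sums_add sums_mult2)
  qed
  ultimately show ?thesis by (simp add: sums_iff s'_def b_def)
qed

end

section \<open>Passage to the boundary\<close>

lemma is_inverse_op_apply:
  assumes "is_inverse_op T S"
  shows "T (S x) = x" "S (T x) = x"
proof -
  have "T o\<^sub>L S = id_blinfun" "S o\<^sub>L T = id_blinfun"
    using assms unfolding is_inverse_op_def by blast+
  then show "T (S x) = x" "S (T x) = x"
    by (metis blinfun_apply_blinfun_compose id_blinfun.rep_eq)+
qed

lemma is_inverse_op_adj:
  assumes "T \<in> BH" "is_inverse_op T S"
  shows "is_inverse_op (adj T) (adj S)"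
proof -
  have S: "S \<in> BH" "T o\<^sub>L S = id_blinfun" "S o\<^sub>L T = id_blinfun"
    using assms(2) unfolding is_inverse_op_def by blast+
  show ?thesis unfolding is_inverse_op_def
    using S assms(1) by (metis adj_in_BH adj_compose adj_id)
qed

lemma adj_id_diff: "T \<in> BH \<Longrightarrow> adj (id_blinfun - T) = id_blinfun - adj T"
  by (intro adj_eqI diff_in_BH adj_in_BH id_in_BH)
    (simp_all add: blinfun.diff_left cinner_diff_left cinner_diff_right cinner_adj)

lemma row_vec_diff: "row_vec X z x - row_vec X \<xi> x = row_vec X (z - \<xi>) x"
  by (simp add: row_vec_def blinfun.sum_left complex_vector.scale_left_diff_distrib sum_subtractf)

context strict_row_contraction
begin

lemma defect_in_BH: "defect \<in> BH"
  unfolding defect_def row_sq_def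
  by (intro diff_in_BH id_in_BH sum_in_BH compose_in_BH adj_in_BH XB)

lemma norm_sub_row_vec_ge:
  assumes "norm z \<le> 1"
  shows "(1 - row_norm X) * norm x \<le> norm (x - row_vec X z x)"
proof -
  have "norm (row_vec X z) \<le> row_norm X"
    using norm_row_vec_le[of X z, OF XB] mult_left_mono[OF assms row_norm_nonneg[of X]] by simp
  then have "norm (row_vec X z x) \<le> row_norm X * norm x"
    using norm_blinfun[of "row_vec X z" x] by (meson mult_right_mono norm_ge_zero order_trans)
  moreover have "norm x \<le> norm (x - row_vec X z x) + norm (row_vec X z x)"
    using norm_triangle_sub[of x "row_vec X z x"] by simp
  ultimately show ?thesis by (simp add: algebra_simps)
qed

text \<open>
  Resolvent identity: \<open>w k - w'\<close> solves the equation at \<open>z k\<close> with right-hand side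
  \<open>X (z k - \<xi>)\<^sup>* w'\<close>, and the inverses are bounded uniformly in \<open>k\<close>.
\<close>

lemma row_vec_resolvent_tendsto:
  assumes z: "\<And>k. norm (z k) \<le> 1" "z \<longlonglongrightarrow> \<xi>"
    and w: "\<And>k. w k - row_vec X (z k) (w k) = u" "w' - row_vec X \<xi> w' = u"
  shows "w \<longlonglongrightarrow> w'"
proof -
  have le: "norm (w k - w') \<le> row_norm X * norm w' / (1 - row_norm X) * norm (z k - \<xi>)" for k
  proof -
    let ?x = "w k - w'"
    have "?x - row_vec X (z k) ?x = (w k - row_vec X (z k) (w k)) - (w' - row_vec X \<xi> w')
        + (row_vec X (z k) w' - row_vec X \<xi> w')"
      by (simp add: blinfun.diff_right)
    also have "\<dots> = row_vec X (z k - \<xi>) w'" by (simp add: w row_vec_diff)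
    finally have "(1 - row_norm X) * norm ?x \<le> norm (row_vec X (z k - \<xi>) w')"
      using norm_sub_row_vec_ge[OF z(1)] by metis
    also have "\<dots> \<le> (row_norm X * norm (z k - \<xi>)) * norm w'"
      using norm_blinfun[of "row_vec X (z k - \<xi>)" w'] norm_row_vec_le[of X "z k - \<xi>", OF XB]
      by (meson mult_right_mono norm_ge_zero order_trans)
    finally show ?thesis using row_norm_less_1 by (simp add: field_simps)
  qed
  have "(\<lambda>k. row_norm X * norm w' / (1 - row_norm X) * norm (z k - \<xi>)) \<longlonglongrightarrow> 0"
    using tendsto_norm_zero[OF Lim_null[THEN iffD1, OF z(2)]] by (rule tendsto_mult_right_zero)
  then have "(\<lambda>k. w k - w') \<longlonglongrightarrow> 0"
    by (rule Lim_null_comparison[OF always_eventually[OF allI[OF le]]])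
  then show ?thesis by (rule Lim_null[THEN iffD2])
qed

text \<open>
  In the two-point inequality at \<open>z k\<close> replace \<open>v\<close> by \<open>v / cnj (g k)\<close>, with \<open>g k\<close> the value of \<open>G\<close>
  at \<open>z k\<close>. The cross term containing \<open>G X\<close> then tends to \<open>0\<close> because \<open>g k\<close> blows up, the other
  cross term loses its factor \<open>g k\<close>, and the factor of \<open>defect_form v v\<close> becomes the quotient with
  limit \<open>M\<close>.
\<close>

lemma boundary_inequality:
  assumes inf: "infinite_dimensional TYPE('a)"
    and hol: "free_holomorphic_with a G" and pos: "Re_positive_on_ball G"
    and z: "\<And>k. norm (z k) < 1" "z \<longlonglongrightarrow> \<xi>"
    and blowup: "filterlim (\<lambda>k. cmod (scalar_value a (z k))) at_top sequentially"
    and M: "(\<lambda>k. Re (scalar_value a (z k)) /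
               ((1 - (norm (z k))\<^sup>2) * (cmod (scalar_value a (z k)))\<^sup>2)) \<longlonglongrightarrow> M"
    and w: "w - row_vec X \<xi> w = defect v"
  shows "0 \<le> Re (cinner (G X h) h) + Re (cinner h w) + M * Re (defect_form v v)"
proof -
  have GB: "G X \<in> BH" by (rule free_holomorphic_in_BH[OF hol in_row_ball])
  define g where "g k = scalar_value a (z k)" for k
  define c where "c k = 1 / cnj (g k)" for k
  define \<beta> where "\<beta> = Re (defect_form v v)"
  have "\<exists>x. x - row_vec X (z k) x = defect v" for k
  proof -
    obtain R where R: "is_inverse_op (id_blinfun - row_vec X (z k)) R"
      using row_vec_inverse[of "z k"] z(1)[of k] less_imp_le by metis
    show ?thesis
      using is_inverse_op_apply(1)[OF R, of "defect v"] by (intro exI[of _ "R (defect v)"]) (simp add: blinfun.diff_left)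
  qed
  then obtain x where x: "\<And>k. x k - row_vec X (z k) (x k) = defect v" by metis
  have x_lim: "x \<longlonglongrightarrow> w"
    using z x w by (intro row_vec_resolvent_tendsto[of z \<xi> x "defect v" w]) (auto intro: less_imp_le)
  have "(\<lambda>k. inverse (cmod (g k))) \<longlonglongrightarrow> 0"
    using blowup unfolding g_def by (rule tendsto_inverse_0_at_top)
  then have c_lim: "c \<longlonglongrightarrow> 0"
    by (intro tendsto_norm_zero_cancel[of c]) (simp add: c_def norm_divide inverse_eq_divide)
  let ?q = "\<lambda>k. Re (g k) / ((1 - (norm (z k))\<^sup>2) * (cmod (g k))\<^sup>2)"
  let ?f = "\<lambda>k. Re (cinner (G X h) h + c k * cinner (G X (x k)) h) + Re (cnj (cinner (x k) h)) + ?q k * \<beta>"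
  have "?f \<longlonglongrightarrow> Re (cinner (G X h) h + 0 * cinner (G X w) h) + Re (cnj (cinner w h)) + M * \<beta>"
    using M unfolding g_def[symmetric]
    by (intro tendsto_intros tendsto_cinner_left c_lim x_lim)
  moreover have "eventually (\<lambda>k. 0 \<le> ?f k) sequentially"
  proof -
    have "eventually (\<lambda>k. cmod (g k) > 0) sequentially"
      using blowup unfolding g_def filterlim_at_top_dense by blast
    then show ?thesis
    proof eventually_elim
      case (elim k)
      then have g0: "g k \<noteq> 0" by simp
      have "c k *\<^sub>C x k - row_vec X (z k) (c k *\<^sub>C x k) = defect (c k *\<^sub>C v)"
        by (simp only: BH_D[OF row_vec_in_BH[OF XB]] BH_D[OF defect_in_BH] x
            flip: complex_vector.scale_right_diff_distrib)
      then have "0 \<le> Re (cinner (G X (h + c k *\<^sub>C x k)) h + g k * (cinner h (c k *\<^sub>C x k)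
          + defect_form (c k *\<^sub>C v) (c k *\<^sub>C v) / of_real (1 - (norm (z k))\<^sup>2)))"
        unfolding g_def by (rule two_point_pick[OF inf hol pos z(1)])
      also have "g k * (cinner h (c k *\<^sub>C x k)
          + defect_form (c k *\<^sub>C v) (c k *\<^sub>C v) / of_real (1 - (norm (z k))\<^sup>2)) =
          cnj (cinner (x k) h) + g k * of_real (\<beta> / ((1 - (norm (z k))\<^sup>2) * (cmod (g k))\<^sup>2))"
      proof -
        have "g k * cnj (c k) = 1" using g0 by (simp add: c_def)
        moreover have "c k * cnj (c k) = 1 / of_real ((cmod (g k))\<^sup>2)"
          by (simp add: c_def complex_norm_square mult.commute del: of_real_power)
        moreover have "cinner h (c k *\<^sub>C x k) = cnj (c k) * cnj (cinner (x k) h)"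
          by (simp only: cinner_scaleC_right flip: cinner_commute)
        moreover have "defect_form (c k *\<^sub>C v) (c k *\<^sub>C v) = (c k * cnj (c k)) * of_real \<beta>"
          unfolding defect.scaleC_left defect.scaleC_right \<beta>_def by (simp flip: defect.self_eq)
        ultimately have "g k * (cinner h (c k *\<^sub>C x k)
            + defect_form (c k *\<^sub>C v) (c k *\<^sub>C v) / of_real (1 - (norm (z k))\<^sup>2)) =
          1 * cnj (cinner (x k) h)
            + g k * (1 / of_real ((cmod (g k))\<^sup>2) * of_real \<beta> / of_real (1 - (norm (z k))\<^sup>2))"
          by (simp only: distrib_left mult.assoc[symmetric])
        then show ?thesis by (simp add: mult.commute)
      qed
      finally show "0 \<le> ?f k"
        by (simp add: blinfun.add_right cinner_add_left BH_D[OF GB] cinner_scaleC_left algebra_simps)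
    qed
  qed
  ultimately have "0 \<le> Re (cinner (G X h) h + 0 * cinner (G X w) h) + Re (cnj (cinner w h)) + M * \<beta>"
    by (intro tendsto_lowerbound) auto
  then show ?thesis by (simp add: \<beta>_def flip: cinner_commute)
qed

text \<open>
  The choice \<open>v = - t R\<^sup>* h\<close> turns the cross term into a multiple of the form that the final estimate
  is about, since \<open>w = R (defect v)\<close>.
\<close>

lemma boundary_quadratic:
  assumes inf: "infinite_dimensional TYPE('a)"
    and hol: "free_holomorphic_with a G" and pos: "Re_positive_on_ball G"
    and z: "\<And>k. norm (z k) < 1" "z \<longlonglongrightarrow> \<xi>"
    and blowup: "filterlim (\<lambda>k. cmod (scalar_value a (z k))) at_top sequentially"
    and M: "(\<lambda>k. Re (scalar_value a (z k)) /
               ((1 - (norm (z k))\<^sup>2) * (cmod (scalar_value a (z k)))\<^sup>2)) \<longlonglongrightarrow> M"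
    and R: "is_inverse_op (id_blinfun - row_vec X \<xi>) R"
  shows "0 \<le> Re (cinner (G X h) h) - t * Re (defect_form (adj R h) (adj R h))
      + M * t\<^sup>2 * Re (defect_form (adj R h) (adj R h))"
proof -
  have RB: "R \<in> BH" using R by (simp add: is_inverse_op_def)
  define y where "y = adj R h"
  define v where "v = (- complex_of_real t) *\<^sub>C y"
  define w where "w = R (defect v)"
  have "w - row_vec X \<xi> w = defect v"
    using is_inverse_op_apply(1)[OF R, of "defect v"] by (simp add: w_def blinfun.diff_left)
  from boundary_inequality[OF inf hol pos z blowup M this, of h]
  have "0 \<le> Re (cinner (G X h) h) + Re (cinner h w) + M * Re (defect_form v v)" .
  moreover have "cinner h w = - of_real t * defect_form y y"
  proof -
    have "cinner h w = cinner y (defect v)" by (simp add: w_def y_def cinner_adj'[OF RB])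
    also have "\<dots> = cnj (defect_form v y)" by (simp add: defect_form_def flip: cinner_commute)
    also have "\<dots> = - of_real t * defect_form y y"
      unfolding v_def defect.scaleC_left by (simp flip: defect.hermitian)
    finally show ?thesis .
  qed
  moreover have "defect_form v v = of_real (t\<^sup>2) * defect_form y y"
    unfolding v_def defect.scaleC_left defect.scaleC_right by (simp add: power2_eq_square)
  ultimately show ?thesis by (simp add: y_def del: of_real_power)
qed

end

theorem theorem7p3:
  fixes G :: "('n::finite \<Rightarrow> ('a::chilbert_space) bop) \<Rightarrow> 'a bop"
    and a :: "'n list \<Rightarrow> complex"
    and z :: "nat \<Rightarrow> complex ^ 'n"
    and \<xi> :: "complex ^ 'n"
    and M :: real
  assumes "separable_space (euclidean :: 'a topology)"
    and "infinite_dimensional TYPE('a)"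
    and "free_holomorphic_with a G"
    and "Re_positive_on_ball G"
    and "\<And>k. norm (z k) < 1"
    and "norm \<xi> = 1"
    and "z \<longlonglongrightarrow> \<xi>"
    and "filterlim (\<lambda>k. cmod (scalar_value a (z k))) at_top sequentially"
    and "(\<lambda>k. Re (scalar_value a (z k)) /
               ((1 - (norm (z k))\<^sup>2) * (cmod (scalar_value a (z k)))\<^sup>2)) \<longlonglongrightarrow> M"
  shows "M > 0 \<and>
    (\<forall>X\<in>row_ball.
       (1 / (4 * M)) *\<^sub>R
         (inv_op (id_blinfun - row_vec X \<xi>) o\<^sub>L (id_blinfun - row_sq X)
            o\<^sub>L inv_op (id_blinfun - vec_row \<xi> X))
       \<le>\<^sub>o Re_op (G X))"
proof -
  note quadratic = strict_row_contraction.boundary_quadratic[OF _ assms(2,3,4,5,7,8,9)]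
  have M_pos: "M > 0"
  proof (rule ccontr)
    assume "\<not> M > 0"
    \<comment> \<open>If \<open>M \<le> 0\<close>, the quadratic inequality fails for large \<open>t\<close> at any single point; take \<open>X = 0\<close>.\<close>
    let ?X = "\<lambda>i::'n. 0 :: 'a bop"
    have "adj (0 :: 'a bop) = 0" by (rule adj_eqI) auto
    then have "row_sq ?X = 0" by (simp add: row_sq_def)
    then have "?X \<in> row_ball" by (simp add: row_ball_def row_norm_def)
    then interpret X: strict_row_contraction ?X by unfold_locales
    obtain h :: 'a where h: "h \<noteq> 0" using infinite_dimensional_nonzero[OF assms(2)] by blast
    obtain R where R: "is_inverse_op (id_blinfun - row_vec ?X \<xi>) R"
      using X.row_vec_inverse[of \<xi>] assms(6) by (metis order_refl)
    have RB: "R \<in> BH" using R by (simp add: is_inverse_op_def)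
    define p where "p = Re (cinner (G ?X h) h)"
    define \<beta> where "\<beta> = Re (X.defect_form (adj R h) (adj R h))"
    have "adj R h \<noteq> 0"
    proof
      assume "adj R h = 0"
      then have "cinner (R ((id_blinfun - row_vec ?X \<xi>) h)) h = 0"
        by (simp only: cinner_adj[OF RB] cinner_zero_right)
      then show False using h by (simp only: is_inverse_op_apply(2)[OF R] cinner_self) simp
    qed
    then have \<beta>: "\<beta> > 0" unfolding \<beta>_def by (rule X.defect.positive)
    let ?t = "(p + 1) / \<beta>"
    have "0 \<le> p - ?t * \<beta> + M * ?t\<^sup>2 * \<beta>"
      unfolding p_def \<beta>_def by (rule quadratic[OF X.strict_row_contraction_axioms R])
    also have "p - ?t * \<beta> = -1" using \<beta> by simp
    also have "M * ?t\<^sup>2 * \<beta> \<le> 0"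
      using \<open>\<not> M > 0\<close> \<beta> by (intro mult_nonpos_nonneg) auto
    finally show False by simp
  qed
  show ?thesis
  proof (intro conjI ballI M_pos)
    fix X :: "'n \<Rightarrow> 'a bop" assume X_ball: "X \<in> row_ball"
    then interpret X: strict_row_contraction X by unfold_locales
    obtain R where R: "is_inverse_op (id_blinfun - row_vec X \<xi>) R"
      using X.row_vec_inverse[of \<xi>] assms(6) by (metis order_refl)
    have RB: "R \<in> BH" using R by (simp add: is_inverse_op_def)
    have TB: "row_vec X \<xi> \<in> BH" by (rule row_vec_in_BH[OF X.XB])
    have "is_inverse_op (id_blinfun - vec_row \<xi> X) (adj R)"
      using is_inverse_op_adj[OF diff_in_BH[OF id_in_BH TB] R]
      by (simp add: adj_id_diff[OF TB] adj_row_vec[OF X.XB])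
    then have inv: "inv_op (id_blinfun - row_vec X \<xi>) = R" "inv_op (id_blinfun - vec_row \<xi> X) = adj R"
      using R by (auto intro: inv_op_eqI)
    show "(1 / (4 * M)) *\<^sub>R
         (inv_op (id_blinfun - row_vec X \<xi>) o\<^sub>L (id_blinfun - row_sq X)
            o\<^sub>L inv_op (id_blinfun - vec_row \<xi> X)) \<le>\<^sub>o Re_op (G X)"
      unfolding op_le_def positive_op_def inv X.defect_def[symmetric]
    proof
      fix h
      let ?D = "X.defect_form (adj R h) (adj R h)"
      have expand: "cinner ((Re_op (G X) - (1 / (4 * M)) *\<^sub>R (R o\<^sub>L X.defect o\<^sub>L adj R)) h) h =
          cinner (Re_op (G X) h) h - of_real (1 / (4 * M)) * ?D"
        by (simp add: blinfun.diff_left blinfun.scaleR_left cinner_diff_left cinner_scaleR_left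
            cinner_adj[OF RB] X.defect_form_def del: of_real_divide)
      \<comment> \<open>\<open>t = 1 / (2 M)\<close> minimises the quadratic and produces the constant \<open>1 / (4 M)\<close>\<close>
      have "0 \<le> Re (cinner (G X h) h) - 1 / (2 * M) * Re ?D + M * (1 / (2 * M))\<^sup>2 * Re ?D"
        by (rule quadratic[OF X.strict_row_contraction_axioms R])
      also have "\<dots> = Re (cinner (Re_op (G X) h) h) - 1 / (4 * M) * Re ?D"
        using M_pos Re_cinner_Re_op[OF free_holomorphic_in_BH[OF assms(3) X_ball], of h]
        by (simp add: field_simps power2_eq_square)
      finally have re: "1 / (4 * M) * Re ?D \<le> Re (cinner (Re_op (G X) h) h)" by simp
      have "cinner (Re_op (G X) h) h \<in> \<real>\<^sub>\<ge>\<^sub>0"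
        using assms(4) X_ball by (simp add: Re_positive_on_ball_def positive_op_def)
      then have im: "Im (cinner (Re_op (G X) h) h) = 0" by (simp add: complex_nonneg_Reals_iff)
      have imD: "Im ?D = 0" by (metis X.defect.self_eq Im_complex_of_real)
      show "cinner ((Re_op (G X) - (1 / (4 * M)) *\<^sub>R (R o\<^sub>L X.defect o\<^sub>L adj R)) h) h \<in> \<real>\<^sub>\<ge>\<^sub>0"
        unfolding expand complex_nonneg_Reals_iff
        using re im imD by (simp del: of_real_divide)
    qed
  qed
qed

end
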